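(* Let $\mathcal X$ be an RD-space and let $\rho$ be an admissible function on $\mathcal X$. Let $\{T_t\}_{t>0}$ be a family of bounded linear operators on $L^2(\mathcal X)$ with integral kernels $\{T_t(x,y)\}_{t>0}$. Assume that there exist constants $C_1\in(0,\infty)$, $\epsilon_1\in(0,1]$, $\epsilon_2\in(0,\infty)$, $\delta\in(0,1]$ and $\gamma\in(0,\infty)$, and a continuous approximation of the identity $\{\widetilde T_t\}_{t>0}$ of order $(\epsilon_1,\epsilon_2)$ with kernels $\{\widetilde T_t(x,y)\}_{t>0}$, such that for all $t\in(0,\infty)$ and $x,y\in\mathcal X$, $$|T_t(x,y)-\widetilde T_t(x,y)|\le C_1\left(\frac t{t+\rho(x)}\right)^\delta\frac1{V_t(x)+V(x,y)}\left(\frac t{t+d(x,y)}\right)^\gamma.$$ Let $T^+(f)(x)=\sup_{t>0}|T_t(f)(x)|$, where $T_t(f)(x)=\int_{\mathcal X}T_t(x,y)f(y)\,d\mu(y)$. Then there exists a positive constant $C$ such that for all $f\in\mathrm{BMO}_\rho(\mathcal X)$, $T^+(f)\in\mathrm{BLO}_\rho(\mathcal X)$ and $$\|T^+(f)\|_{\mathrm{BLO}_\rho(\mathcal X)}\le C\|f\|_{\mathrm{BMO}_\rho(\mathcal X)}.$$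
   Context: RD-space: $(\mathcal X,d)$ is a metric space with a regular Borel measure $\mu$ such that all balls $B(x,r)=\{y: d(x,y)<r\}$ have finite and positive measure; $\mu$ is doubling, i.e. there is $A_1\ge1$ with $\mu(B(x,2r))\le A_1\mu(B(x,r))$ for all $x\in\mathcal X$, $r>0$; and there are $0<\kappa\le n$, $A_2\in(0,1]$, $A_3\in[1,\infty)$ such that $A_2\lambda^\kappa\mu(B(x,r))\le\mu(B(x,\lambda r))\le A_3\lambda^n\mu(B(x,r))$ for all $x\in\mathcal X$, $0<r\le \mathrm{diam}(\mathcal X)/2$ and $1\le\lambda\le \mathrm{diam}(\mathcal X)/(2r)$. Balls are understood together with their center and radius. Write $V_r(x)=\mu(B(x,r))$ and $V(x,y)=\mu(B(x,d(x,y)))$. Admissible function: $\rho:\mathcal X\to(0,\infty)$ is admissible if there are positive constants $C_0,k_0$ such that $\frac1{\rho(x)}\le C_0\frac1{\rho(y)}\left(1+\frac{d(x,y)}{\rho(y)}\right)^{k_0}$ for all $x,y\in\mathcal X$. Continuous approximation of the identity of order $(\epsilon_1,\epsilon_2)$: a family $\{S_t\}_{t>0}$ of bounded linear integral operators on $L^2(\mathcal X)$ with measurable kernels $S_t(x,y):\mathcal X\times\mathcal X\to\mathbb C$ for which there is a positive constant $A_4$ such that for all $t>0$ and $x,x',y\in\mathcal X$: (i) $|S_t(x,y)|\le A_4\frac1{V_t(x)+V_t(y)+V(x,y)}\frac{t^{\epsilon_2}}{(t+d(x,y))^{\epsilon_2}}$; (ii) $|S_t(x,y)-S_t(x',y)|\le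 A_4\left(\frac{d(x,x')}{t+d(x,y)}\right)^{\epsilon_1}\frac1{V_t(x)+V_t(y)+V(x,y)}\frac{t^{\epsilon_2}}{(t+d(x,y))^{\epsilon_2}}$ whenever $d(x,x')\le(t+d(x,y))/2$; (iii) property (ii) also holds with the roles of $x$ and $y$ interchanged; (iv) $\int_{\mathcal X}S_t(x,z)\,d\mu(z)=1=\int_{\mathcal X}S_t(z,y)\,d\mu(z)$. $L^1_{\rm loc}(\mathcal X)$ means integrable on every ball; $f_B=\frac1{\mu(B)}\int_B f\,d\mu$. With $\mathcal D$ the collection of balls $B(x,r)$ with $r\ge\rho(x)$, $\mathrm{BMO}_\rho(\mathcal X)$ and $\mathrm{BLO}_\rho(\mathcal X)$ (the latter consisting of real-valued functions) are the sets of $f\in L^1_{\rm loc}(\mathcal X)$ for which, respectively, the following are finite: $$\|f\|_{\mathrm{BMO}_\rho(\mathcal X)}=\sup_{B\notin\mathcal D}\frac1{\mu(B)}\int_B|f-f_B|\,d\mu+\sup_{B\in\mathcal D}\frac1{\mu(B)}\int_B|f|\,d\mu,$$ $$\|f\|_{\mathrm{BLO}_\rho(\mathcal X)}=\sup_{B\notin\mathcal D}\frac1{\mu(B)}\int_B\left[f-\operatorname*{ess\,inf}_B f\right]d\mu+\sup_{B\in\mathcal D}\frac1{\mu(B)}\int_B|f|\,d\mu.$$ As usual, the kernels $T_t(x,y)$ and the maximal functions $T^+(f)$ are understood to be measurable. *)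

theory Defs
  imports "HOL-Analysis.Analysis"
begin

(* Regularity in the sense used for Borel measures on metric spaces: outer by open sets, inner by
   closed sets.  It is implied by inner regularity with respect to compact sets. *)
definition regular_borel_measure :: "'a::metric_space measure \<Rightarrow> bool" where
  "regular_borel_measure M \<longleftrightarrow> sets M = sets borel \<and>
     (\<forall>A\<in>sets M.
        emeasure M A = (INF U\<in>{U. open U \<and> A \<subseteq> U}. emeasure M U) \<and>
        emeasure M A = (SUP F\<in>{F. closed F \<and> F \<subseteq> A}. emeasure M F))"

(* The library constant diameter is real-valued and unspecified on unbounded sets. *)
definition ediameter :: "'a::metric_space set \<Rightarrow> ereal" where
  "ediameter A = (SUP x\<in>A. SUP y\<in>A. ereal (dist x y))"

definition rd_space :: "'a::metric_space measure \<Rightarrow> bool" where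
  "rd_space M \<longleftrightarrow> regular_borel_measure M \<and>
     (\<forall>x r. 0 < r \<longrightarrow> 0 < emeasure M (ball x r) \<and> emeasure M (ball x r) < \<infinity>) \<and>
     (\<exists>A1\<ge>1. \<forall>x r. 0 < r \<longrightarrow> measure M (ball x (2 * r)) \<le> A1 * measure M (ball x r)) \<and>
     (\<exists>\<kappa> n A2 A3. 0 < \<kappa> \<and> \<kappa> \<le> n \<and> 0 < A2 \<and> A2 \<le> 1 \<and> 1 \<le> A3 \<and>
        (\<forall>x r \<Lambda>. 0 < r \<and> ereal r \<le> ediameter (UNIV :: 'a set) / 2 \<and>
            1 \<le> \<Lambda> \<and> ereal \<Lambda> \<le> ediameter (UNIV :: 'a set) / ereal (2 * r) \<longrightarrow>
            A2 * \<Lambda> powr \<kappa> * measure M (ball x r) \<le> measure M (ball x (\<Lambda> * r)) \<and>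
            measure M (ball x (\<Lambda> * r)) \<le> A3 * \<Lambda> powr n * measure M (ball x r)))"

definition vol :: "'a::metric_space measure \<Rightarrow> real \<Rightarrow> 'a \<Rightarrow> real" where
  "vol M r x = measure M (ball x r)"

definition vol2 :: "'a::metric_space measure \<Rightarrow> 'a \<Rightarrow> 'a \<Rightarrow> real" where
  "vol2 M x y = measure M (ball x (dist x y))"

definition admissible :: "('a::metric_space \<Rightarrow> real) \<Rightarrow> bool" where
  "admissible \<rho> \<longleftrightarrow> (\<forall>x. 0 < \<rho> x) \<and>
     (\<exists>C0>0. \<exists>k0>0. \<forall>x y. 1 / \<rho> x \<le> C0 * (1 / \<rho> y) * (1 + dist x y / \<rho> y) powr k0)"

(* Elements of L^2 are represented by functions; operator identities hold almost everywhere. *)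
definition L2_space :: "'a measure \<Rightarrow> ('a \<Rightarrow> complex) set" where
  "L2_space M = {f \<in> borel_measurable M. integrable M (\<lambda>x. (cmod (f x))\<^sup>2)}"

definition L2_norm :: "'a measure \<Rightarrow> ('a \<Rightarrow> complex) \<Rightarrow> real" where
  "L2_norm M f = sqrt (LINT x|M. (cmod (f x))\<^sup>2)"

definition bounded_linear_L2 :: "'a measure \<Rightarrow> (('a \<Rightarrow> complex) \<Rightarrow> 'a \<Rightarrow> complex) \<Rightarrow> bool" where
  "bounded_linear_L2 M T \<longleftrightarrow>
     (\<forall>f\<in>L2_space M. T f \<in> L2_space M) \<and>
     (\<forall>f\<in>L2_space M. \<forall>g\<in>L2_space M. AE x in M. T (\<lambda>y. f y + g y) x = T f x + T g x) \<and>
     (\<forall>c. \<forall>f\<in>L2_space M. AE x in M. T (\<lambda>y. c * f y) x = c * T f x) \<and>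
     (\<exists>B. \<forall>f\<in>L2_space M. L2_norm M (T f) \<le> B * L2_norm M f)"

definition has_integral_kernel ::
  "'a measure \<Rightarrow> (('a \<Rightarrow> complex) \<Rightarrow> 'a \<Rightarrow> complex) \<Rightarrow> ('a \<Rightarrow> 'a \<Rightarrow> complex) \<Rightarrow> bool" where
  "has_integral_kernel M T k \<longleftrightarrow>
     case_prod k \<in> borel_measurable (M \<Otimes>\<^sub>M M) \<and>
     (\<forall>f\<in>L2_space M. AE x in M.
        integrable M (\<lambda>y. k x y * f y) \<and> T f x = (LINT y|M. k x y * f y))"

definition cont_approx_identity ::
  "'a::metric_space measure \<Rightarrow> real \<Rightarrow> real \<Rightarrow>
   (real \<Rightarrow> ('a \<Rightarrow> complex) \<Rightarrow> 'a \<Rightarrow> complex) \<Rightarrow> (real \<Rightarrow> 'a \<Rightarrow> 'a \<Rightarrow> complex) \<Rightarrow> bool" where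
  "cont_approx_identity M \<epsilon>1 \<epsilon>2 S s \<longleftrightarrow>
     (\<forall>t>0. bounded_linear_L2 M (S t) \<and> has_integral_kernel M (S t) (s t)) \<and>
     (\<exists>A4>0. \<forall>t>0.
        (\<forall>x y. cmod (s t x y) \<le>
           A4 * (1 / (vol M t x + vol M t y + vol2 M x y)) *
             (t powr \<epsilon>2 / (t + dist x y) powr \<epsilon>2)) \<and>
        (\<forall>x x' y. dist x x' \<le> (t + dist x y) / 2 \<longrightarrow>
           cmod (s t x y - s t x' y) \<le>
             A4 * (dist x x' / (t + dist x y)) powr \<epsilon>1 *
               (1 / (vol M t x + vol M t y + vol2 M x y)) *
               (t powr \<epsilon>2 / (t + dist x y) powr \<epsilon>2)) \<and>
        (\<forall>x y y'. dist y y' \<le> (t + dist x y) / 2 \<longrightarrow>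
           cmod (s t x y - s t x y') \<le>
             A4 * (dist y y' / (t + dist x y)) powr \<epsilon>1 *
               (1 / (vol M t x + vol M t y + vol2 M x y)) *
               (t powr \<epsilon>2 / (t + dist x y) powr \<epsilon>2))) \<and>
     (\<forall>t>0. (\<forall>x. (LINT z|M. s t x z) = 1) \<and> (\<forall>y. (LINT z|M. s t z y) = 1))"

definition L1_loc ::
  "'a::metric_space measure \<Rightarrow> ('a \<Rightarrow> 'b::{banach, second_countable_topology}) set" where
  "L1_loc M = {f. \<forall>x r. 0 < r \<longrightarrow> set_integrable M (ball x r) f}"

definition avg ::
  "'a measure \<Rightarrow> 'a set \<Rightarrow> ('a \<Rightarrow> 'b::{banach, second_countable_topology}) \<Rightarrow> 'b" where
  "avg M B f = (LINT y:B|M. f y) /\<^sub>R measure M B"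

definition nn_avg :: "'a measure \<Rightarrow> 'a set \<Rightarrow> ('a \<Rightarrow> ennreal) \<Rightarrow> ennreal" where
  "nn_avg M B g = (\<integral>\<^sup>+y\<in>B. g y \<partial>M) / emeasure M B"

definition ess_inf :: "'a measure \<Rightarrow> 'a set \<Rightarrow> ('a \<Rightarrow> real) \<Rightarrow> ereal" where
  "ess_inf M B f = Sup {c. AE y in M. y \<in> B \<longrightarrow> c \<le> ereal (f y)}"

(* A ball is a pair of center and (positive) radius; small_balls is the complement of
   large_balls among all balls. *)
definition large_balls :: "('a::metric_space \<Rightarrow> real) \<Rightarrow> ('a \<times> real) set" where
  "large_balls \<rho> = {(x, r). 0 < r \<and> \<rho> x \<le> r}"

definition small_balls :: "('a::metric_space \<Rightarrow> real) \<Rightarrow> ('a \<times> real) set" where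
  "small_balls \<rho> = {(x, r). 0 < r \<and> \<not> \<rho> x \<le> r}"

definition bmo_norm ::
  "'a::metric_space measure \<Rightarrow> ('a \<Rightarrow> real) \<Rightarrow> ('a \<Rightarrow> complex) \<Rightarrow> ennreal" where
  "bmo_norm M \<rho> f =
     (SUP (x, r)\<in>small_balls \<rho>.
        nn_avg M (ball x r) (\<lambda>y. ennreal (cmod (f y - avg M (ball x r) f)))) +
     (SUP (x, r)\<in>large_balls \<rho>. nn_avg M (ball x r) (\<lambda>y. ennreal (cmod (f y))))"

definition BMO :: "'a::metric_space measure \<Rightarrow> ('a \<Rightarrow> real) \<Rightarrow> ('a \<Rightarrow> complex) set" where
  "BMO M \<rho> = {f \<in> L1_loc M. bmo_norm M \<rho> f < \<infinity>}"

(* The difference below is nonnegative almost everywhere on the ball, so e2ennreal truncates only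
   on a null set; it equals infinity if the essential infimum is minus infinity. *)
definition blo_norm ::
  "'a::metric_space measure \<Rightarrow> ('a \<Rightarrow> real) \<Rightarrow> ('a \<Rightarrow> real) \<Rightarrow> ennreal" where
  "blo_norm M \<rho> f =
     (SUP (x, r)\<in>small_balls \<rho>.
        nn_avg M (ball x r) (\<lambda>y. e2ennreal (ereal (f y) - ess_inf M (ball x r) f))) +
     (SUP (x, r)\<in>large_balls \<rho>. nn_avg M (ball x r) (\<lambda>y. ennreal \<bar>f y\<bar>))"

definition BLO :: "'a::metric_space measure \<Rightarrow> ('a \<Rightarrow> real) \<Rightarrow> ('a \<Rightarrow> real) set" where
  "BLO M \<rho> = {f \<in> L1_loc M. blo_norm M \<rho> f < \<infinity>}"

definition max_fun ::
  "'a measure \<Rightarrow> (real \<Rightarrow> 'a \<Rightarrow> 'a \<Rightarrow> complex) \<Rightarrow> ('a \<Rightarrow> complex) \<Rightarrow> 'a \<Rightarrow> ennreal" where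
  "max_fun M k f x = (SUP t\<in>{0<..}. ennreal (cmod (LINT y|M. k t x y * f y)))"

end

theory Submission
  imports Defs
begin

text \<open>
  Everything rests on one comparison: for \<open>f\<close> in BMO with norm \<open>n\<close> and every \<open>t > 0\<close>,
  the value \<open>T\<^sub>t f(x)\<close> differs from the mean of \<open>f\<close> over \<open>B(x,t)\<close> by at most a constant
  multiple of \<open>n\<close>.  For the approximation of the identity this holds because its kernel has
  integral one and decays along the dyadic annuli around \<open>x\<close>, while means over concentric dyadic
  balls drift by at most a multiple of \<open>n\<close> per step (\<open>approx_identity_mean\<close>).  For the
  perturbation there is no cancellation, but the average of \<open>|f|\<close> over \<open>B(x,s)\<close> is at most a
  multiple of \<open>n (1 + \<rho>(x)/s)\<^sup>\<delta>\<close>, and at scale \<open>t\<close> this growth is compensated exactly by the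
  factor \<open>(t/(t + \<rho>(x)))\<^sup>\<delta>\<close> (\<open>average_cmod_le\<close>, \<open>perturbation_le\<close>).

  So, up to a multiple of \<open>n\<close>, the maximal function at \<open>x\<close> is the supremum over \<open>t\<close> of the moduli
  of the means over \<open>B(x,t)\<close>.  Fix a ball \<open>B\<close> of radius \<open>r\<close> and split this supremum at \<open>t = r\<close>.
  Scales from \<open>r\<close> on see nearly the same means from every point of \<open>B\<close>, so they contribute at
  most the value of the maximal function at any other point of \<open>B\<close> plus a multiple of \<open>n\<close>, and
  that value may be replaced by the infimum over \<open>B\<close>; if \<open>B\<close> is large compared with \<open>\<rho>\<close>, these
  means are themselves bounded by multiples of \<open>n\<close>.  Scales below \<open>r\<close> add to this at most the
  local excess: the supremum over \<open>j\<close> of the distance from the mean over \<open>B(x, r / 2\<^sup>j)\<close> to the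
  mean over \<open>B\<close>.

  What remains is that the average over \<open>B\<close> of the local excess is at most a multiple of \<open>n\<close>.  This
  is a John--Nirenberg estimate, proved directly for the means instead of for \<open>f\<close>: at each
  point stop at the first scale where the mean has moved away from the mean over \<open>B\<close> by more than
  a fixed multiple of \<open>n\<close>, select disjoint stopping balls by a Vitali argument, and iterate inside
  their doubles, whose total measure is at most half that of \<open>B\<close> (\<open>stopping_balls\<close>,
  \<open>john_nirenberg_means\<close>).  The exceptional sets thus decay exponentially, which bounds the
  integral of the excess.
\<close>

section \<open>Vitali selection and measure estimates\<close>

text \<open>
  The usual Vitali argument for sets whose sizes are indexed by a natural number, a smaller index
  meaning a larger set.  Zorn's lemma is applied to the disjoint subfamilies that already dominate
  everything they meet; were a member of \<open>E\<close> missed by a maximal one, the missed member of least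
  index could be added.
\<close>

lemma vitali_selection:
  fixes U :: "'i \<Rightarrow> 'a set" and j :: "'i \<Rightarrow> nat"
  assumes ne: "\<And>x. x \<in> E \<Longrightarrow> U x \<noteq> {}"
  shows "\<exists>S\<subseteq>E. disjoint_family_on U S \<and> (\<forall>x\<in>E. \<exists>y\<in>S. j y \<le> j x \<and> U x \<inter> U y \<noteq> {})"
proof -
  define \<Omega> where "\<Omega> = {S. S \<subseteq> E \<and> disjoint_family_on U S \<and>
     (\<forall>x\<in>E. (\<exists>y\<in>S. U x \<inter> U y \<noteq> {}) \<longrightarrow> (\<exists>y\<in>S. j y \<le> j x \<and> U x \<inter> U y \<noteq> {}))}"
  have "\<Union>C \<in> \<Omega>" if "subset.chain \<Omega> C" for C
  proof -
    have C: "C \<subseteq> \<Omega>" and ch: "\<And>X Y. X \<in> C \<Longrightarrow> Y \<in> C \<Longrightarrow> X \<subseteq> Y \<or> Y \<subseteq> X"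
      using that by (auto simp: subset.chain_def)
    have "disjoint_family_on U (\<Union>C)"
      unfolding disjoint_family_on_def
    proof (intro ballI impI)
      fix x y assume "x \<in> \<Union>C" "y \<in> \<Union>C" and xy: "x \<noteq> y"
      then obtain X Y where XY: "X \<in> C" "Y \<in> C" "x \<in> X" "y \<in> Y" by blast
      then obtain Z where "Z \<in> C" "x \<in> Z" "y \<in> Z" using ch[of X Y] by blast
      then show "U x \<inter> U y = {}"
        using C xy by (auto simp: \<Omega>_def disjoint_family_on_def)
    qed
    moreover have "\<Union>C \<subseteq> E" using C by (auto simp: \<Omega>_def)
    moreover have "\<exists>y\<in>\<Union>C. j y \<le> j x \<and> U x \<inter> U y \<noteq> {}"
      if x: "x \<in> E" and meets: "\<exists>y\<in>\<Union>C. U x \<inter> U y \<noteq> {}" for x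
    proof -
      obtain Z y where "Z \<in> C" "y \<in> Z" "U x \<inter> U y \<noteq> {}" using meets by blast
      then have "\<exists>y\<in>Z. j y \<le> j x \<and> U x \<inter> U y \<noteq> {}"
        using C x by (auto simp: \<Omega>_def)
      then show ?thesis using \<open>Z \<in> C\<close> by blast
    qed
    ultimately show ?thesis by (auto simp: \<Omega>_def)
  qed
  then obtain S where S: "S \<in> \<Omega>" and max: "\<And>X. X \<in> \<Omega> \<Longrightarrow> S \<subseteq> X \<Longrightarrow> X = S"
    using subset_Zorn'[of \<Omega>] by metis
  have "\<exists>y\<in>S. U x \<inter> U y \<noteq> {}" if "x \<in> E" for x
  proof (rule ccontr)
    assume none: "\<not> ?thesis"
    define P where "P z \<longleftrightarrow> z \<in> E \<and> (\<forall>y\<in>S. U z \<inter> U y = {})" for z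
    have "P x" using none that by (auto simp: P_def)
    then obtain z where z: "P z" and zmin: "\<And>w. P w \<Longrightarrow> j z \<le> j w"
      using ex_has_least_nat[of P x j] by blast
    have "insert z S \<in> \<Omega>"
      unfolding \<Omega>_def
    proof (intro CollectI conjI ballI impI)
      show "insert z S \<subseteq> E" using S z by (auto simp: \<Omega>_def P_def)
      show "disjoint_family_on U (insert z S)"
        using S z by (fastforce simp: \<Omega>_def P_def disjoint_family_on_def)
      fix w assume w: "w \<in> E" "\<exists>y\<in>insert z S. U w \<inter> U y \<noteq> {}"
      show "\<exists>y\<in>insert z S. j y \<le> j w \<and> U w \<inter> U y \<noteq> {}"
      proof (cases "P w")
        case True
        then show ?thesis using w(2) zmin[of w] by (auto simp: P_def)
      next
        case False
        then show ?thesis using w S by (auto simp: P_def \<Omega>_def)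
      qed
    qed
    then have "z \<in> S" using max[of "insert z S"] by blast
    then show False using z ne[of z] by (auto simp: P_def)
  qed
  then have "\<exists>y\<in>S. j y \<le> j x \<and> U x \<inter> U y \<noteq> {}" if "x \<in> E" for x
    using S that by (auto simp: \<Omega>_def)
  then show ?thesis using S by (auto simp: \<Omega>_def intro!: exI[of _ S])
qed

text \<open>
  Reduces a countable union to its finite partial unions, so that the children of a ball in the
  stopping argument only have to be summed over finite sets.
\<close>

lemma emeasure_UN_le_finite_sums:
  assumes S: "countable S" and U: "\<And>y. y \<in> S \<Longrightarrow> U y \<in> sets M"
    and le: "\<And>F. finite F \<Longrightarrow> F \<subseteq> S \<Longrightarrow> (\<Sum>y\<in>F. emeasure M (U y)) \<le> K"
  shows "emeasure M (\<Union>y\<in>S. U y) \<le> K"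
proof (cases "S = {}")
  case False
  define F where "F n = from_nat_into S ` {..n::nat}" for n
  have F: "finite (F n)" "F n \<subseteq> S" for n
    using from_nat_into[OF False] by (auto simp: F_def)
  have "(\<Union>n. F n) = S"
    using range_from_nat_into[OF False S] unfolding F_def by blast
  then have "(\<Union>y\<in>S. U y) = (\<Union>n. \<Union>y\<in>F n. U y)" by blast
  moreover have "emeasure M (\<Union>n. \<Union>y\<in>F n. U y) = (SUP n. emeasure M (\<Union>y\<in>F n. U y))"
  proof (rule SUP_emeasure_incseq[symmetric])
    show "range (\<lambda>n. \<Union>y\<in>F n. U y) \<subseteq> sets M"
      using F U by (auto intro!: sets.finite_UN)
    show "incseq (\<lambda>n. \<Union>y\<in>F n. U y)"
      unfolding F_def by (intro monoI UN_mono image_mono) auto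
  qed
  moreover have "emeasure M (\<Union>y\<in>F n. U y) \<le> K" for n
    using F[of n] U
    by (intro order.trans[OF emeasure_subadditive_finite le]) auto
  ultimately show ?thesis by (simp add: SUP_le_iff)
qed simp

text \<open>
  The layer-cake estimate: \<open>h\<close> is dominated on \<open>B\<close> by the sum over \<open>m\<close> of \<open>L\<close> times the
  indicator of \<open>U m\<close>, since a point lying in \<open>U 0\<close>, ..., \<open>U (m - 1)\<close> but not in \<open>U m\<close> has
  \<open>h x \<le> m L\<close>, and a point in all \<open>U m\<close> makes the sum infinite.
\<close>

lemma nn_integral_le_of_geometric_tails:
  fixes h :: "'a \<Rightarrow> ennreal"
  assumes U: "\<And>m. U m \<in> sets M" "\<And>m. emeasure M (U m) \<le> ennreal ((1/2) ^ m * K)"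
    and h: "\<And>m x. x \<in> B \<Longrightarrow> x \<notin> U m \<Longrightarrow> h x \<le> ennreal (real m * L)"
    and L: "0 < L" and K: "0 \<le> K"
  shows "(\<integral>\<^sup>+x\<in>B. h x \<partial>M) \<le> ennreal (2 * L * K)"
proof -
  have "h x * indicator B x \<le> (\<Sum>m. ennreal L * indicator (U m) x)" for x
  proof (cases "x \<in> B")
    case xB: True
    show ?thesis
    proof (cases "\<exists>m. x \<notin> U m")
      case True
      define m where "m = (LEAST m. x \<notin> U m)"
      have m: "x \<notin> U m" unfolding m_def using True by (metis LeastI_ex)
      have im: "x \<in> U i" if "i < m" for i
        using not_less_Least[of i "\<lambda>m. x \<notin> U m"] that by (auto simp: m_def)
      have "h x \<le> ennreal (real m * L)" using h[OF xB m] .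
      also have "\<dots> = (\<Sum>i<m. ennreal L * indicator (U i) x)"
        using im L by (simp add: ennreal_mult flip: ennreal_of_nat_eq_real_of_nat)
      also have "\<dots> \<le> (\<Sum>i. ennreal L * indicator (U i) x)"
        by (rule sum_le_suminf) auto
      finally show ?thesis using xB by simp
    next
      case False
      have "(\<Sum>i. ennreal L * indicator (U i) x) = (\<integral>\<^sup>+i. ennreal L \<partial>count_space (UNIV :: nat set))"
        using False by (subst nn_integral_count_space_nat) simp
      also have "\<dots> = top"
        using L by (simp add: ennreal_mult_top)
      finally show ?thesis by simp
    qed
  qed simp
  then have "(\<integral>\<^sup>+x\<in>B. h x \<partial>M) \<le> (\<integral>\<^sup>+x. (\<Sum>m. ennreal L * indicator (U m) x) \<partial>M)"
    by (intro nn_integral_mono)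
  also have "\<dots> = (\<Sum>m. ennreal L * emeasure M (U m))"
    using U(1) by (simp add: nn_integral_suminf nn_integral_cmult)
  also have "\<dots> \<le> (\<Sum>m. ennreal (L * K * (1/2) ^ m))"
  proof (intro suminf_le summableI)
    fix m
    have "ennreal L * emeasure M (U m) \<le> ennreal L * ennreal ((1/2) ^ m * K)"
      by (intro mult_left_mono U) simp
    also have "\<dots> = ennreal (L * K * (1/2) ^ m)"
      using L K by (simp add: ennreal_mult mult_ac)
    finally show "ennreal L * emeasure M (U m) \<le> ennreal (L * K * (1/2) ^ m)" .
  qed
  also have "\<dots> = ennreal (L * K * 2)"
  proof -
    have "(\<lambda>m. L * K * (1/2) ^ m) sums (L * K * 2)"
      using geometric_sums[of "1/2::real"] by (intro sums_mult) simp
    then show ?thesis using L K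
      by (subst suminf_ennreal2) (auto simp: sums_iff)
  qed
  finally show ?thesis by (simp add: mult_ac)
qed

section \<open>Means over balls in a doubling space\<close>

locale doubling_measure =
  fixes M :: "'a::metric_space measure" and A :: real
  assumes sets_M: "sets M = sets borel"
    and ball_pos: "\<And>x r. 0 < r \<Longrightarrow> 0 < emeasure M (ball x r)"
    and ball_fin: "\<And>x r. 0 < r \<Longrightarrow> emeasure M (ball x r) < \<infinity>"
    and doubling: "\<And>x r. 0 < r \<Longrightarrow> measure M (ball x (2 * r)) \<le> A * measure M (ball x r)"
    and A_ge_1: "1 \<le> A"
begin

lemma space_M [simp]: "space M = UNIV"
  using sets_eq_imp_space_eq[OF sets_M] by simp

lemma open_sets_M: "open U \<Longrightarrow> U \<in> sets M"
  by (simp add: sets_M)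

lemma ball_sets [measurable, simp]: "ball x r \<in> sets M"
  by (simp add: open_sets_M)

lemma emeasure_ball: "0 < r \<Longrightarrow> emeasure M (ball x r) = ennreal (measure M (ball x r))"
  using ball_fin[of r x] by (intro emeasure_eq_ennreal_measure) auto

lemma measure_ball_pos: "0 < r \<Longrightarrow> 0 < measure M (ball x r)"
  using ball_pos[of r x] emeasure_ball[of r x] by simp

lemma A_power_ge_1: "1 \<le> A ^ k"
  using A_ge_1 by (rule one_le_power)

lemma measure_ball_mono: "0 < r' \<Longrightarrow> ball x r \<subseteq> ball x' r' \<Longrightarrow> measure M (ball x r) \<le> measure M (ball x' r')"
  using ball_fin[of r' x'] by (intro measure_mono_fmeasurable) (auto simp: fmeasurable_def)

lemma measure_ball_power: "0 < r \<Longrightarrow> measure M (ball x (2 ^ k * r)) \<le> A ^ k * measure M (ball x r)"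
proof (induction k)
  case (Suc k)
  have "measure M (ball x (2 ^ Suc k * r)) \<le> A * measure M (ball x (2 ^ k * r))"
    using doubling[of "2 ^ k * r" x] Suc.prems by (simp add: mult_ac)
  also have "\<dots> \<le> A * (A ^ k * measure M (ball x r))"
    using Suc A_ge_1 by (intro mult_left_mono) auto
  finally show ?case by (simp add: mult_ac)
qed simp

text \<open>
  The larger ball is contained in a ball of radius \<open>2 r\<close> around the centre \<open>x'\<close> of the smaller
  one; this costs one doubling in addition to the \<open>k\<close> doublings between the radii.
\<close>

lemma measure_ball_le_sub_ball:
  assumes "0 < r'" "dist x x' + r' \<le> r" "r \<le> 2 ^ k * r'"
  shows "measure M (ball x r) \<le> A ^ Suc k * measure M (ball x' r')"
proof -
  have "ball x r \<subseteq> ball x' (2 ^ Suc k * r')"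
  proof
    fix y assume "y \<in> ball x r"
    then show "y \<in> ball x' (2 ^ Suc k * r')"
      using assms dist_triangle[of x' y x] by (auto simp: dist_commute)
  qed
  then have "measure M (ball x r) \<le> measure M (ball x' (2 ^ Suc k * r'))"
    using assms(1) by (intro measure_ball_mono) auto
  also have "\<dots> \<le> A ^ Suc k * measure M (ball x' r')"
    using assms(1) by (rule measure_ball_power)
  finally show ?thesis .
qed

text \<open>
  Disjoint balls inside a fixed ball have summable measures, and a summable family of positive
  numbers is countable.  Countability lets the exceptional sets of the selected balls be united.
\<close>

lemma countable_disjoint_balls:
  fixes r :: "'a \<Rightarrow> real"
  assumes r: "\<And>y. y \<in> S \<Longrightarrow> 0 < r y"
    and disj: "disjoint_family_on (\<lambda>y. ball y (r y)) S"
    and sub: "\<And>y. y \<in> S \<Longrightarrow> ball y (r y) \<subseteq> ball x R"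
  shows "countable S"
proof (cases "S = {}")
  case False
  then obtain y where "y \<in> S" by blast
  then have R: "0 < R" using sub[of y] r[of y] by (metis ball_empty centre_in_ball empty_iff in_mono not_le)
  have "(\<Sum>y\<in>F. measure M (ball y (r y))) \<le> measure M (ball x R)" if F: "finite F" "F \<subseteq> S" for F
  proof -
    have "disjoint_family_on (\<lambda>y. ball y (r y)) F"
      using F(2) disj by (rule disjoint_family_on_mono)
    moreover have "emeasure M (ball y (r y)) \<noteq> \<infinity>" if "y \<in> F" for y
      using ball_fin[OF r, of y y] F that by auto
    ultimately have "(\<Sum>y\<in>F. measure M (ball y (r y))) = measure M (\<Union>y\<in>F. ball y (r y))"
      using F(1) by (intro measure_finite_Union[symmetric]) auto
    also have "\<dots> \<le> measure M (ball x R)"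
      using F sub ball_fin[OF R, of x] by (intro measure_mono_fmeasurable) (auto simp: fmeasurable_def)
    finally show ?thesis .
  qed
  then have "(\<lambda>y. measure M (ball y (r y))) summable_on S"
    by (intro nonneg_bdd_above_summable_on bdd_aboveI2[where M = "measure M (ball x R)"]) simp_all
  from summable_countable_real[OF this] have "countable {y \<in> S. measure M (ball y (r y)) \<noteq> 0}" .
  moreover have "{y \<in> S. measure M (ball y (r y)) \<noteq> 0} = S"
    using measure_ball_pos[OF r] by (force simp: less_le)
  ultimately show ?thesis by simp
qed simp

end

locale locally_integrable = doubling_measure M A for M :: "'a::metric_space measure" and A :: real +
  fixes f :: "'a \<Rightarrow> complex"
  assumes L1_loc: "f \<in> L1_loc M"
begin

abbreviation mean :: "'a \<Rightarrow> real \<Rightarrow> complex" where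
  "mean x r \<equiv> avg M (ball x r) f"

lemma f_int: "set_integrable M (ball x r) f"
  using L1_loc by (cases "0 < r") (auto simp: L1_loc_def ball_empty)

lemma f_measurable [measurable]: "f \<in> borel_measurable M"
proof (rule borel_measurable_LIMSEQ_metric)
  show "(\<lambda>x. indicator (ball undefined (real i)) x *\<^sub>R f x) \<in> borel_measurable M" for i
    using f_int[of undefined i] unfolding set_integrable_def by auto
  show "(\<lambda>i. indicator (ball undefined (real i)) x *\<^sub>R f x) \<longlonglongrightarrow> f x" for x
  proof (rule tendsto_eventually)
    obtain N where "dist undefined x < real N" using reals_Archimedean2 by blast
    then show "\<forall>\<^sub>F i in sequentially. indicator (ball undefined (real i)) x *\<^sub>R f x = f x"
      by (intro eventually_sequentiallyI[of N]) auto
  qed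
qed

lemma const_int: "set_integrable M (ball x r) (\<lambda>_. c :: complex)"
proof (cases "0 < r")
  case True
  then show ?thesis using ball_fin[of r x]
    unfolding set_integrable_def by (simp add: top.not_eq_extremum)
qed (simp add: ball_empty)

lemma diff_int: "set_integrable M (ball x r) (\<lambda>y. f y - c)"
  by (intro set_integral_diff f_int const_int)

lemma cmod_diff_int: "set_integrable M (ball x r) (\<lambda>y. cmod (f y - c))"
  using diff_int[of x r c] by (rule set_integrable_norm)

lemma nn_integral_cmod_diff:
  "(\<integral>\<^sup>+y\<in>ball x r. ennreal (cmod (f y - c)) \<partial>M) = ennreal (LINT y:ball x r|M. cmod (f y - c))"
proof -
  have "(\<integral>\<^sup>+y\<in>ball x r. ennreal (cmod (f y - c)) \<partial>M)
      = (\<integral>\<^sup>+y. ennreal (indicator (ball x r) y *\<^sub>R cmod (f y - c)) \<partial>M)"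
    by (intro nn_integral_cong) (auto simp: indicator_def)
  also have "\<dots> = ennreal (LINT y:ball x r|M. cmod (f y - c))"
    unfolding set_lebesgue_integral_def
    by (intro nn_integral_eq_integral cmod_diff_int[unfolded set_integrable_def]) auto
  finally show ?thesis .
qed

lemma integral_cmod_diff_shift:
  assumes "0 < r"
  shows "(LINT y:ball x r|M. cmod (f y - c)) \<le> (LINT y:ball x r|M. cmod (f y - d)) + measure M (ball x r) * cmod (d - c)"
proof -
  have cint: "set_integrable M (ball x r) (\<lambda>y. cmod (d - c))"
    using const_int[of x r "d - c"] by (rule set_integrable_norm)
  have "(LINT y:ball x r|M. cmod (f y - c)) \<le> (LINT y:ball x r|M. cmod (f y - d) + cmod (d - c))"
    by (intro set_integral_mono set_integral_add cmod_diff_int cint norm_diff_triangle_le[OF order.refl order.refl])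
  also have "\<dots> = (LINT y:ball x r|M. cmod (f y - d)) + measure M (ball x r) * cmod (d - c)"
    using ball_fin[OF assms, of x]
    by (subst set_integral_add(2)[OF cmod_diff_int cint], subst set_integral_const) auto
  finally show ?thesis .
qed

lemma mean_diff_eq:
  assumes "0 < r"
  shows "measure M (ball x r) *\<^sub>R (mean x r - c) = (LINT y:ball x r|M. f y - c)"
proof -
  have "(LINT y:ball x r|M. c) = measure M (ball x r) *\<^sub>R c"
    using ball_fin[OF assms, of x] by (intro set_integral_const) auto
  then show ?thesis
    using measure_ball_pos[OF assms, of x]
    by (simp add: set_integral_diff(2)[OF f_int const_int] avg_def scaleR_right_diff_distrib)
qed

text \<open>
  With \<open>c\<close> the mean over the larger ball this compares two means; with \<open>c = 0\<close> it bounds a mean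
  by the average of the modulus; with \<open>c\<close> the mean over the initial ball it gives the weak-type
  bound for the stopping balls.
\<close>

lemma mean_diff_le:
  assumes "0 < r'" "ball x' r' \<subseteq> ball x r"
  shows "measure M (ball x' r') * cmod (mean x' r' - c) \<le> (LINT y:ball x r|M. cmod (f y - c))"
proof -
  have "measure M (ball x' r') * cmod (mean x' r' - c) = cmod (LINT y:ball x' r'|M. f y - c)"
    using mean_diff_eq[OF assms(1), of x' c, symmetric] by simp
  also have "\<dots> \<le> (LINT y:ball x' r'|M. cmod (f y - c))"
    by (rule set_integral_norm_bound[OF diff_int])
  also have "\<dots> \<le> (LINT y:ball x r|M. cmod (f y - c))"
    using assms(2) cmod_diff_int unfolding set_lebesgue_integral_def set_integrable_def
    by (intro integral_mono) (auto simp: indicator_def)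
  finally show ?thesis .
qed

end

text \<open>
  The oscillation is bounded on all balls, small or large compared with \<open>\<rho>\<close>: on a large ball it is
  controlled by the average of the modulus.  The bound \<open>n\<close> is kept positive because it serves as
  the stopping threshold; the degenerate case is recovered at the end by letting the bound
  decrease to the norm.
\<close>

locale bmo_function = locally_integrable M A f
  for M :: "'a::metric_space measure" and A :: real and f :: "'a \<Rightarrow> complex" +
  fixes n :: real
  assumes n_pos: "0 < n"
    and oscillation: "\<And>x r. 0 < r \<Longrightarrow>
      (LINT y:ball x r|M. cmod (f y - avg M (ball x r) f)) \<le> n * measure M (ball x r)"
begin

text \<open>
  The power of \<open>A\<close> pays for replacing the measure of the larger ball by that of the smaller one.
  All later comparisons of means at comparable scales are chains of this one.
\<close>

lemma mean_sub_ball: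
  assumes "0 < r'" "dist x x' + r' \<le> r" "r \<le> 2 ^ k * r'"
  shows "cmod (mean x' r' - mean x r) \<le> A ^ Suc k * n"
proof -
  have r: "0 < r" using assms by (smt (verit) zero_le_dist)
  have "ball x' r' \<subseteq> ball x r"
  proof
    fix y assume "y \<in> ball x' r'"
    then show "y \<in> ball x r" using assms(2) dist_triangle[of x y x'] by simp
  qed
  then have "measure M (ball x' r') * cmod (mean x' r' - mean x r) \<le> (LINT y:ball x r|M. cmod (f y - mean x r))"
    by (rule mean_diff_le[OF assms(1)])
  also have "\<dots> \<le> n * measure M (ball x r)" by (rule oscillation[OF r])
  also have "\<dots> \<le> n * (A ^ Suc k * measure M (ball x' r'))"
    using measure_ball_le_sub_ball[OF assms] n_pos by (intro mult_left_mono) auto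
  finally have "measure M (ball x' r') * cmod (mean x' r' - mean x r) \<le> measure M (ball x' r') * (A ^ Suc k * n)"
    by (simp add: mult_ac)
  then show ?thesis using measure_ball_pos[OF assms(1), of x'] by simp
qed

lemma mean_dyadic: "0 < s \<Longrightarrow> cmod (mean x s - mean x (2 ^ k * s)) \<le> real k * (A\<^sup>2 * n)"
proof (induction k)
  case (Suc k)
  have "cmod (mean x (2 ^ k * s) - mean x (2 ^ Suc k * s)) \<le> A ^ Suc 1 * n"
    using Suc.prems by (intro mean_sub_ball) auto
  moreover have "cmod (mean x s - mean x (2 ^ k * s)) \<le> real k * (A\<^sup>2 * n)"
    using Suc by blast
  ultimately have "cmod (mean x s - mean x (2 ^ Suc k * s)) \<le> real k * (A\<^sup>2 * n) + A ^ Suc 1 * n"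
    using norm_diff_triangle_le by blast
  then show ?case by (simp add: algebra_simps power2_eq_square)
qed simp

end

section \<open>A John--Nirenberg estimate for the means\<close>

context bmo_function
begin

text \<open>
  The stopping threshold.  It is chosen so that the doubled stopping balls of \<open>stopping_balls\<close>
  carry at most half of the measure, and so that no point stops at the initial scale.
\<close>

definition jump :: real where
  "jump = 2 * A\<^sup>2 * (1 + A\<^sup>2) * n"

lemma jump_pos: "0 < jump"
  using A_ge_1 n_pos by (simp add: jump_def add_pos_pos)

lemma mean_shift:
  assumes "0 < s" "dist x y < s"
  shows "cmod (mean x s - mean y s) \<le> 2 * A\<^sup>2 * n"
proof -
  have "cmod (mean x s - mean y (2 * s)) \<le> A ^ Suc 1 * n"
    using assms by (intro mean_sub_ball) (auto simp: dist_commute)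
  moreover have "cmod (mean y (2 * s) - mean y s) \<le> A ^ Suc 1 * n"
    using assms by (subst norm_minus_commute, intro mean_sub_ball) auto
  ultimately have "cmod (mean x s - mean y s) \<le> A ^ Suc 1 * n + A ^ Suc 1 * n"
    using norm_diff_triangle_le by blast
  then show ?thesis by (simp add: power2_eq_square)
qed

text \<open>
  Stopping balls centred in \<open>B(x,r)\<close> may leave this ball but stay in its double, so the weak-type
  estimate needs the oscillation of \<open>f\<close> around its mean over \<open>B(x,r)\<close> on the double.
\<close>

lemma oscillation_double:
  assumes r: "0 < r"
  shows "(LINT y:ball x (2 * r)|M. cmod (f y - mean x r)) \<le> A * (1 + A\<^sup>2) * n * measure M (ball x r)"
proof -
  let ?B = "ball x (2 * r)"
  let ?d = "cmod (mean x r - mean x (2 * r))"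
  have d: "?d \<le> A\<^sup>2 * n"
    using r mean_dyadic[of r x 1] by simp
  have "(LINT y:?B|M. cmod (f y - mean x r)) \<le> (LINT y:?B|M. cmod (f y - mean x (2 * r))) + measure M ?B * ?d"
    using r integral_cmod_diff_shift[of "2 * r" x "mean x r" "mean x (2 * r)"]
    by (simp add: norm_minus_commute)
  also have "\<dots> \<le> n * measure M ?B + measure M ?B * (A\<^sup>2 * n)"
    using r d by (intro add_mono oscillation mult_left_mono) auto
  also have "\<dots> = ((1 + A\<^sup>2) * n) * measure M ?B" by (simp add: algebra_simps)
  also have "\<dots> \<le> ((1 + A\<^sup>2) * n) * (A * measure M (ball x r))"
    using r n_pos by (intro mult_left_mono doubling) auto
  finally show ?thesis by (simp add: mult_ac)
qed

text \<open>
  For each point of the ball at which some mean has moved by more than the threshold, let \<open>J x\<close> be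
  the first dyadic scale where this happens.  A disjoint Vitali subfamily of the balls
  \<open>B(x, r / 2\<^bsup>J x\<^esup>)\<close> has total measure controlled by the oscillation divided by the threshold, and
  the balls of twice the radius, that is of radius \<open>r / 2\<^bsup>i x\<^esup>\<close> with \<open>i x = J x - 1\<close>, cover all
  stopped points.  Since \<open>J x\<close> is minimal, the mean over such a doubled ball is still within the
  threshold, and so are the means around each covered point down to the scale of the doubled ball.
  These two facts let the next generation restart without any loss in the constants.
\<close>

lemma stopping_balls:
  assumes r: "0 < r"
  obtains S :: "'a set" and i :: "'a \<Rightarrow> nat" where
    "countable S"
    "\<And>y. y \<in> S \<Longrightarrow> cmod (mean y (r / 2 ^ i y) - mean x0 r) \<le> jump"
    "\<And>x. x \<in> ball x0 r \<Longrightarrow> (\<forall>j. cmod (mean x (r / 2 ^ j) - mean x0 r) \<le> jump) \<or>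
       (\<exists>y\<in>S. x \<in> ball y (r / 2 ^ i y) \<and> (\<forall>j\<le>i y. cmod (mean x (r / 2 ^ j) - mean x0 r) \<le> jump))"
    "\<And>F. finite F \<Longrightarrow> F \<subseteq> S \<Longrightarrow>
       (\<Sum>y\<in>F. measure M (ball y (r / 2 ^ i y))) \<le> measure M (ball x0 r) / 2"
proof -
  define g where "g x j = cmod (mean x (r / 2 ^ j) - mean x0 r)" for x j
  define E where "E = {x \<in> ball x0 r. \<exists>j. jump < g x j}"
  define J where "J x = (LEAST j. jump < g x j)" for x
  define U where "U x = ball x (r / 2 ^ J x)" for x
  have J: "jump < g x (J x)" if "x \<in> E" for x
    using that unfolding E_def J_def by (auto intro: LeastI)
  have J_less: "g x j \<le> jump" if "j < J x" for x j
    using not_less_Least[of j "\<lambda>j. jump < g x j"] that unfolding J_def by simp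
  have J_pos: "0 < J x" if "x \<in> E" for x
  proof (rule ccontr)
    assume "\<not> 0 < J x"
    then have "jump < cmod (mean x r - mean x0 r)" using J[OF that] by (simp add: g_def)
    also have "\<dots> \<le> 2 * A\<^sup>2 * n * 1"
      using that r mean_shift[of r x x0] by (simp add: E_def dist_commute)
    also have "\<dots> \<le> 2 * A\<^sup>2 * n * (1 + A\<^sup>2)"
      using n_pos by (intro mult_left_mono) auto
    finally show False by (simp add: jump_def mult_ac)
  qed
  have "\<exists>S\<subseteq>E. disjoint_family_on U S \<and> (\<forall>x\<in>E. \<exists>y\<in>S. J y \<le> J x \<and> U x \<inter> U y \<noteq> {})"
    by (rule vitali_selection) (use r in \<open>simp add: U_def not_le\<close>)
  then obtain S where S: "S \<subseteq> E" "disjoint_family_on U S"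
    and cover: "\<And>x. x \<in> E \<Longrightarrow> \<exists>y\<in>S. J y \<le> J x \<and> U x \<inter> U y \<noteq> {}"
    by blast
  have rJ: "r / 2 ^ j \<le> r" for j
    using r by (simp add: divide_le_eq)
  have sub: "U y \<subseteq> ball x0 (2 * r)" if "y \<in> S" for y
  proof
    fix z assume "z \<in> U y"
    then have "dist y z < r" using rJ[of "J y"] by (simp add: U_def)
    moreover have "dist x0 y < r" using that S by (auto simp: E_def)
    ultimately show "z \<in> ball x0 (2 * r)" using dist_triangle[of x0 z y] by simp
  qed
  have cnt: "countable S"
    using S(2) sub r unfolding U_def
    by (intro countable_disjoint_balls[of S "\<lambda>y. r / 2 ^ J y" x0 "2 * r"]) simp_all
  define i where "i x = J x - 1" for x
  have i: "J y = Suc (i y)" if "y \<in> S" for y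
    using J_pos[of y] S that by (auto simp: i_def)
  show thesis
  proof (rule that[of S i], unfold g_def[symmetric])
    show "g y (i y) \<le> jump" if "y \<in> S" for y
      using J_less[of "i y" y] i[OF that] by simp
    \<comment> \<open>A stopped point meets a selected ball of no smaller radius, hence lies in its double.\<close>
    show "(\<forall>j. g x j \<le> jump) \<or> (\<exists>y\<in>S. x \<in> ball y (r / 2 ^ i y) \<and> (\<forall>j\<le>i y. g x j \<le> jump))"
      if x: "x \<in> ball x0 r" for x
    proof (cases "x \<in> E")
      case True
      then obtain y where y: "y \<in> S" "J y \<le> J x" "U x \<inter> U y \<noteq> {}" using cover by blast
      then obtain z where "dist x z < r / 2 ^ J x" "dist y z < r / 2 ^ J y" by (auto simp: U_def)
      moreover have "r / 2 ^ J x \<le> r / 2 ^ J y"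
        using y(2) r by (intro divide_left_mono power_increasing) auto
      moreover have "r / 2 ^ i y = 2 * (r / 2 ^ J y)" using i[OF y(1)] by simp
      ultimately have "x \<in> ball y (r / 2 ^ i y)"
        using dist_triangle[of y x z] by (simp add: dist_commute)
      moreover have "g x j \<le> jump" if "j \<le> i y" for j
        using J_less[of j x] that i[OF y(1)] y(2) by simp
      ultimately show ?thesis using y(1) by blast
    next
      case False
      then show ?thesis using x by (auto simp: E_def not_less)
    qed
    fix F assume F: "finite F" "F \<subseteq> S"
    \<comment> \<open>On each stopping ball the mean has moved by more than the threshold: a weak-type bound.\<close>
    have "jump * (\<Sum>y\<in>F. measure M (U y)) \<le> (\<Sum>y\<in>F. LINT z:U y|M. cmod (f z - mean x0 r))"
      unfolding sum_distrib_left
    proof (rule sum_mono)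
      fix y assume "y \<in> F"
      then have "jump * measure M (U y) \<le> measure M (U y) * g y (J y)"
        using J[of y] F S by (subst mult.commute, intro mult_left_mono) auto
      also have "\<dots> \<le> (LINT z:U y|M. cmod (f z - mean x0 r))"
        unfolding U_def g_def using r by (intro mean_diff_le) auto
      finally show "jump * measure M (U y) \<le> (LINT z:U y|M. cmod (f z - mean x0 r))" .
    qed
    also have "\<dots> = (LINT z:(\<Union>y\<in>F. U y)|M. cmod (f z - mean x0 r))"
      using F(1) disjoint_family_on_mono[OF F(2) S(2)]
      by (intro set_integral_finite_Union[symmetric]) (simp_all add: U_def cmod_diff_int disjoint_family_on_def)
    also have "\<dots> \<le> (LINT z:ball x0 (2 * r)|M. cmod (f z - mean x0 r))"
    proof -
      have UF: "(\<Union>y\<in>F. U y) \<subseteq> ball x0 (2 * r)" using F sub by blast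
      have "set_integrable M (\<Union>y\<in>F. U y) (\<lambda>z. cmod (f z - mean x0 r))"
        using F by (intro set_integrable_subset[OF cmod_diff_int _ UF]) (auto simp: U_def intro!: sets.finite_UN)
      then show ?thesis
        using UF cmod_diff_int[of x0 "2 * r" "mean x0 r"]
        unfolding set_lebesgue_integral_def set_integrable_def
        by (intro integral_mono) (auto simp: indicator_def)
    qed
    also have "\<dots> \<le> A * (1 + A\<^sup>2) * n * measure M (ball x0 r)"
      by (rule oscillation_double[OF r])
    finally have *: "jump * (\<Sum>y\<in>F. measure M (U y)) \<le> A * (1 + A\<^sup>2) * n * measure M (ball x0 r)" .
    have "(\<Sum>y\<in>F. measure M (ball y (r / 2 ^ i y))) \<le> (\<Sum>y\<in>F. A * measure M (U y))"
    proof (rule sum_mono)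
      fix y assume "y \<in> F"
      then have "r / 2 ^ i y = 2 * (r / 2 ^ J y)" using i[of y] F by auto
      then show "measure M (ball y (r / 2 ^ i y)) \<le> A * measure M (U y)"
        using doubling[of "r / 2 ^ J y" y] r by (simp add: U_def)
    qed
    then have "jump * (\<Sum>y\<in>F. measure M (ball y (r / 2 ^ i y))) \<le> jump * (A * (\<Sum>y\<in>F. measure M (U y)))"
      using jump_pos by (intro mult_left_mono) (auto simp: sum_distrib_left)
    also have "\<dots> \<le> A * (A * (1 + A\<^sup>2) * n * measure M (ball x0 r))"
      using mult_left_mono[OF *, of A] A_ge_1 by (simp add: mult_ac)
    also have "\<dots> = jump * (measure M (ball x0 r) / 2)"
      by (simp add: jump_def power2_eq_square)
    finally show "(\<Sum>y\<in>F. measure M (ball y (r / 2 ^ i y))) \<le> measure M (ball x0 r) / 2"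
      using jump_pos by simp
  qed (rule cnt)
qed

text \<open>
  Induction on \<open>m\<close> for all balls simultaneously.  The exceptional set of a ball is the union of the
  exceptional sets, one level lower, of its doubled stopping balls, so its measure is halved.  Off this set, a
  point within a doubled stopping ball loses at most one threshold between the two balls and the rest
  inside; the scales above that ball are within one threshold by construction.
\<close>

lemma john_nirenberg_means:
  fixes x0 :: 'a and r :: real
  assumes "0 < r"
  shows "\<exists>U. open U \<and> emeasure M U \<le> ennreal ((1/2) ^ m * measure M (ball x0 r)) \<and>
    (\<forall>x\<in>ball x0 r - U. \<forall>j. cmod (mean x (r / 2 ^ j) - mean x0 r) \<le> real m * jump)"
  using assms
proof (induction m arbitrary: x0 r)
  case 0
  then show ?case by (intro exI[of _ "ball x0 r"]) (simp add: emeasure_ball)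
next
  case (Suc m)
  obtain S i where S: "countable S"
    and child: "\<And>y. y \<in> S \<Longrightarrow> cmod (mean y (r / 2 ^ i y) - mean x0 r) \<le> jump"
    and cover: "\<And>x. x \<in> ball x0 r \<Longrightarrow> (\<forall>j. cmod (mean x (r / 2 ^ j) - mean x0 r) \<le> jump) \<or>
       (\<exists>y\<in>S. x \<in> ball y (r / 2 ^ i y) \<and> (\<forall>j\<le>i y. cmod (mean x (r / 2 ^ j) - mean x0 r) \<le> jump))"
    and small: "\<And>F. finite F \<Longrightarrow> F \<subseteq> S \<Longrightarrow>
       (\<Sum>y\<in>F. measure M (ball y (r / 2 ^ i y))) \<le> measure M (ball x0 r) / 2"
    by (rule stopping_balls[OF Suc.prems, of x0]) (rule that)
  have "\<exists>U. \<forall>y. open (U y) \<and> emeasure M (U y) \<le> ennreal ((1/2) ^ m * measure M (ball y (r / 2 ^ i y))) \<and>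
    (\<forall>x\<in>ball y (r / 2 ^ i y) - U y. \<forall>j. cmod (mean x (r / 2 ^ i y / 2 ^ j) - mean y (r / 2 ^ i y)) \<le> real m * jump)"
    by (intro choice allI Suc.IH) (use Suc.prems in auto)
  then obtain U where U: "\<And>y. open (U y)"
    "\<And>y. emeasure M (U y) \<le> ennreal ((1/2) ^ m * measure M (ball y (r / 2 ^ i y)))"
    "\<And>x y j. x \<in> ball y (r / 2 ^ i y) \<Longrightarrow> x \<notin> U y \<Longrightarrow>
        cmod (mean x (r / 2 ^ i y / 2 ^ j) - mean y (r / 2 ^ i y)) \<le> real m * jump"
    by (metis DiffI)
  have "emeasure M (\<Union>y\<in>S. U y) \<le> ennreal ((1/2) ^ Suc m * measure M (ball x0 r))"
  proof (rule emeasure_UN_le_finite_sums[OF S])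
    show "U y \<in> sets M" for y using U(1) by (rule open_sets_M)
    fix F assume F: "finite F" "F \<subseteq> S"
    have "(\<Sum>y\<in>F. emeasure M (U y)) \<le> (\<Sum>y\<in>F. ennreal ((1/2) ^ m * measure M (ball y (r / 2 ^ i y))))"
      by (intro sum_mono U(2))
    also have "\<dots> = ennreal ((1/2) ^ m * (\<Sum>y\<in>F. measure M (ball y (r / 2 ^ i y))))"
      by (simp add: sum_distrib_left)
    also have "\<dots> \<le> ennreal ((1/2) ^ m * (measure M (ball x0 r) / 2))"
      using small[OF F] by (intro ennreal_leI mult_left_mono) auto
    finally show "(\<Sum>y\<in>F. emeasure M (U y)) \<le> ennreal ((1/2) ^ Suc m * measure M (ball x0 r))"
      by simp
  qed
  moreover have "cmod (mean x (r / 2 ^ j) - mean x0 r) \<le> real (Suc m) * jump"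
    if x: "x \<in> ball x0 r" "x \<notin> (\<Union>y\<in>S. U y)" for x j
  proof -
    have le: "jump \<le> real (Suc m) * jump" using jump_pos by simp
    consider "cmod (mean x (r / 2 ^ j) - mean x0 r) \<le> jump"
      | y where "y \<in> S" "x \<in> ball y (r / 2 ^ i y)" "i y < j"
      using cover[OF x(1)] by (metis not_le)
    then show ?thesis
    proof cases
      case 2
      have "r / 2 ^ j = r / 2 ^ i y / 2 ^ (j - i y)"
        using 2(3) by (simp flip: power_add)
      then have "cmod (mean x (r / 2 ^ j) - mean y (r / 2 ^ i y)) \<le> real m * jump"
        using U(3)[OF 2(2), of "j - i y"] 2(1) x(2) by auto
      then have "cmod (mean x (r / 2 ^ j) - mean x0 r) \<le> real m * jump + jump"
        using child[OF 2(1)] by (rule norm_diff_triangle_le)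
      then show ?thesis by (simp add: algebra_simps)
    qed (use le in simp)
  qed
  ultimately show ?case
    using U(1) by (intro exI[of _ "\<Union>y\<in>S. U y"]) auto
qed

text \<open>
  The local maximal function of the means, relative to \<open>B(x0,r)\<close> and restricted to scales below
  \<open>r\<close>.  Dyadic scales suffice by \<open>mean_le_excess\<close>.
\<close>

definition excess :: "'a \<Rightarrow> real \<Rightarrow> 'a \<Rightarrow> ennreal" where
  "excess x0 r x = (SUP j. ennreal (cmod (mean x (r / 2 ^ j) - mean x0 r)))"

lemma nn_integral_excess:
  assumes r: "0 < r" and h: "\<And>x. x \<in> ball x0 r \<Longrightarrow> h x \<le> excess x0 r x"
  shows "(\<integral>\<^sup>+x\<in>ball x0 r. h x \<partial>M) \<le> ennreal (2 * jump * measure M (ball x0 r))"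
proof -
  obtain U where U: "\<And>m. open (U m)"
    "\<And>m. emeasure M (U m) \<le> ennreal ((1/2) ^ m * measure M (ball x0 r))"
    "\<And>m x j. x \<in> ball x0 r \<Longrightarrow> x \<notin> U m \<Longrightarrow> cmod (mean x (r / 2 ^ j) - mean x0 r) \<le> real m * jump"
    using john_nirenberg_means[OF r, of _ x0] by (metis DiffI)
  show ?thesis
  proof (rule nn_integral_le_of_geometric_tails)
    show "h x \<le> ennreal (real m * jump)" if "x \<in> ball x0 r" "x \<notin> U m" for m x
      using h[OF that(1)] U(3)[OF that]
      by (elim order.trans) (auto simp: excess_def intro!: SUP_least ennreal_leI)
  qed (use U open_sets_M jump_pos in auto)
qed

lemma mean_le_excess:
  assumes "0 < t" "t \<le> r"
  shows "ennreal (cmod (mean x t - mean x0 r)) \<le> excess x0 r x + ennreal (A\<^sup>2 * n)"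
proof -
  define j where "j = (LEAST j. r / 2 ^ Suc j < t)"
  have "\<exists>j. r / t < 2 ^ Suc j"
    using real_arch_pow[of 2 "r / t"] by (metis lessI one_less_numeral_iff order.strict_trans power_strict_increasing semiring_norm(76))
  then have ex: "\<exists>j. r / 2 ^ Suc j < t"
    using assms by (simp add: field_simps)
  then have j1: "r / 2 ^ Suc j < t" unfolding j_def by (rule LeastI_ex)
  have j2: "t \<le> r / 2 ^ j"
  proof (cases j)
    case (Suc k)
    then show ?thesis using not_less_Least[of k "\<lambda>j. r / 2 ^ Suc j < t"] by (simp add: j_def)
  qed (use assms in simp)
  have "cmod (mean x t - mean x (r / 2 ^ j)) \<le> A ^ Suc 1 * n"
    using assms j1 j2 by (intro mean_sub_ball) (auto simp: field_simps)
  then have "cmod (mean x t - mean x0 r) \<le> A ^ Suc 1 * n + cmod (mean x (r / 2 ^ j) - mean x0 r)"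
    by (rule norm_diff_triangle_le) simp
  then have "ennreal (cmod (mean x t - mean x0 r)) \<le> ennreal (A ^ Suc 1 * n + cmod (mean x (r / 2 ^ j) - mean x0 r))"
    by (rule ennreal_leI)
  also have "\<dots> = ennreal (A\<^sup>2 * n) + ennreal (cmod (mean x (r / 2 ^ j) - mean x0 r))"
    using n_pos A_ge_1 by (simp add: power2_eq_square)
  also have "\<dots> \<le> ennreal (A\<^sup>2 * n) + excess x0 r x"
    unfolding excess_def by (intro add_left_mono SUP_upper) simp
  finally show ?thesis by (simp add: add.commute)
qed

end

section \<open>Integral operators compared with means\<close>

context doubling_measure
begin

text \<open>
  The sum over dyadic annuli of the kernel decay \<open>2\<^bsup>- \<epsilon> j\<^esup>\<close> against the at most linear growth
  \<open>j + 1\<close> of averages, times the constant lost in \<open>kernel_le_annulus\<close>.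
\<close>

definition tail_const :: "real \<Rightarrow> real" where
  "tail_const \<epsilon> = A * 2 powr \<epsilon> / (1 - 2 powr - \<epsilon>)\<^sup>2"

lemma tail_const_pos: "0 < \<epsilon> \<Longrightarrow> 0 < tail_const \<epsilon>"
  using A_ge_1 by (auto simp: tail_const_def intro!: divide_pos_pos mult_pos_pos zero_less_power)

definition growth_const :: "real \<Rightarrow> real" where
  "growth_const \<delta> = 2 * A\<^sup>2 * 2 powr \<delta> / (2 powr \<delta> - 1)"

lemma growth_const_pos: "0 < \<delta> \<Longrightarrow> 0 < growth_const \<delta>"
  using A_ge_1 by (auto simp: growth_const_def intro!: divide_pos_pos)

text \<open>
  If an operator family is within \<open>K n\<close> of the means, this multiple of \<open>n\<close> is lost in comparing its
  maximal function at two points of a ball.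
\<close>

definition transfer_const :: "real \<Rightarrow> real" where
  "transfer_const K = 4 * A\<^sup>2 + 2 * K"

text \<open>
  The first summand comes from integrating the local excess: it is \<open>2 * jump / n\<close>.
\<close>

definition blo_const :: "real \<Rightarrow> real" where
  "blo_const K = 4 * A\<^sup>2 * (1 + A\<^sup>2) + transfer_const K"

lemma blo_const_pos: "0 \<le> K \<Longrightarrow> 0 < blo_const K"
  using A_ge_1 by (simp add: blo_const_def transfer_const_def add_pos_nonneg)

text \<open>
  The index \<open>j\<close> is the first one with \<open>y\<close> in \<open>B(x, 2\<^sup>j t)\<close>.  For \<open>j > 0\<close> the point lies outside
  the previous ball, whose measure is therefore at most \<open>V(x,y)\<close>, and the decay factor gains
  \<open>2\<^bsup>- \<epsilon>\<^esup>\<close> per step.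
\<close>

lemma kernel_le_annulus:
  assumes t: "0 < t" and \<epsilon>: "0 < \<epsilon>"
  obtains j :: nat where "y \<in> ball x (2 ^ j * t)"
    "1 / (vol M t x + vol2 M x y) * (t / (t + dist x y)) powr \<epsilon>
      \<le> A * 2 powr \<epsilon> * (2 powr - \<epsilon>) ^ j / measure M (ball x (2 ^ j * t))"
proof -
  define j where "j = (LEAST j. dist x y < 2 ^ j * t)"
  have "\<exists>j. dist x y / t < 2 ^ j" by (rule real_arch_pow) simp
  then have "\<exists>j. dist x y < 2 ^ j * t" using t by (simp add: field_simps)
  then have j: "dist x y < 2 ^ j * t" unfolding j_def by (rule LeastI_ex)
  let ?V = "vol M t x + vol2 M x y"
  have Vt: "0 < vol M t x" "0 \<le> vol2 M x y"
    using measure_ball_pos[OF t, of x] by (simp_all add: vol_def vol2_def)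
  have pw: "0 \<le> t / (t + dist x y)" using t by simp
  have \<mu>: "0 < measure M (ball x (2 ^ j * t))" using t by (intro measure_ball_pos) simp
  have "1 / ?V * (t / (t + dist x y)) powr \<epsilon>
      \<le> A * 2 powr \<epsilon> * (2 powr - \<epsilon>) ^ j / measure M (ball x (2 ^ j * t))"
  proof (cases j)
    case 0
    have "1 / ?V * (t / (t + dist x y)) powr \<epsilon> \<le> 1 / vol M t x * 1"
      using Vt t \<epsilon> by (intro mult_mono frac_le powr_le1) (auto simp: divide_le_eq_1 add_pos_nonneg)
    also have "\<dots> \<le> (A * 2 powr \<epsilon>) * (1 / vol M t x)"
      using Vt(1) A_ge_1 ge_one_powr_ge_zero[of 2 \<epsilon>] \<epsilon> mult_mono[of 1 A 1 "2 powr \<epsilon>"]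
      by (auto simp: divide_right_mono)
    finally show ?thesis using 0 by (simp add: vol_def)
  next
    case (Suc k)
    have k: "2 ^ k * t \<le> dist x y"
      using not_less_Least[of k "\<lambda>j. dist x y < 2 ^ j * t"] Suc by (simp add: j_def)
    have "measure M (ball x (2 ^ j * t)) \<le> A * measure M (ball x (2 ^ k * t))"
      using doubling[of "2 ^ k * t" x] t Suc by (simp add: mult_ac)
    also have "\<dots> \<le> A * ?V"
    proof (intro mult_left_mono)
      have "measure M (ball x (2 ^ k * t)) \<le> vol2 M x y"
        unfolding vol2_def using t k by (intro measure_ball_mono subset_ball) (smt (verit) mult_pos_pos zero_less_power)+
      then show "measure M (ball x (2 ^ k * t)) \<le> ?V" using Vt by simp
    qed (use A_ge_1 in simp)
    finally have V: "1 / ?V \<le> A / measure M (ball x (2 ^ j * t))"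
      using \<mu> Vt by (simp add: field_simps)
    have "t / (t + dist x y) \<le> t / (2 ^ k * t)"
      using k t by (intro divide_left_mono) (auto simp: add_pos_nonneg)
    also have "\<dots> = 2 powr - real k" using t by (simp add: powr_minus powr_realpow field_simps)
    finally have "(t / (t + dist x y)) powr \<epsilon> \<le> (2 powr - real k) powr \<epsilon>"
      using pw \<epsilon> by (intro powr_mono2) auto
    also have "\<dots> = 2 powr \<epsilon> * (2 powr - \<epsilon>) ^ j"
      by (simp add: powr_powr powr_power Suc flip: powr_add)
    finally have P: "(t / (t + dist x y)) powr \<epsilon> \<le> 2 powr \<epsilon> * (2 powr - \<epsilon>) ^ j" .
    have "1 / ?V * (t / (t + dist x y)) powr \<epsilon> \<le> A / measure M (ball x (2 ^ j * t)) * (2 powr \<epsilon> * (2 powr - \<epsilon>) ^ j)"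
      using V P A_ge_1 by (intro mult_mono) auto
    then show ?thesis by (simp add: field_simps)
  qed
  then show ?thesis using that[of j] j by simp
qed

text \<open>
  A kernel with the size and decay of an approximation of the identity integrates any function
  whose averages over the balls \<open>B(x, 2\<^sup>j t)\<close> grow at most linearly in \<open>j\<close>: by
  \<open>kernel_le_annulus\<close> the kernel is dominated by a geometric series of normalised indicators.
\<close>

lemma kernel_integral_le:
  fixes h F :: "'a \<Rightarrow> real"
  assumes t: "0 < t" and \<epsilon>: "0 < \<epsilon>" and a: "0 \<le> a" and b: "0 \<le> b"
    and F0: "\<And>y. 0 \<le> F y" and F [measurable]: "F \<in> borel_measurable M"
    and h: "\<And>y. h y \<le> a * (1 / (vol M t x + vol2 M x y)) * (t / (t + dist x y)) powr \<epsilon>"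
    and F_ball: "\<And>j::nat. (\<integral>\<^sup>+y\<in>ball x (2 ^ j * t). ennreal (F y) \<partial>M)
        \<le> ennreal (b * (real j + 1) * measure M (ball x (2 ^ j * t)))"
  shows "(\<integral>\<^sup>+y. ennreal (h y * F y) \<partial>M) \<le> ennreal (a * b * tail_const \<epsilon>)"
proof -
  define q where "q = 2 powr - \<epsilon>"
  define c where "c = a * (A * 2 powr \<epsilon>)"
  define B where "B j = ball x (2 ^ j * t)" for j :: nat
  have q: "0 < q" "q < 1" using \<epsilon> by (auto simp: q_def powr_less_one)
  have c: "0 \<le> c" using a A_ge_1 by (simp add: c_def)
  have B: "B j \<in> sets M" "0 < measure M (B j)" for j
    using t measure_ball_pos[of "2 ^ j * t" x] by (auto simp: B_def)
  have "ennreal (h y * F y) \<le> (\<Sum>j. ennreal (c * q ^ j / measure M (B j)) * (ennreal (F y) * indicator (B j) y))" for y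
  proof -
    obtain j where j: "y \<in> B j"
      "1 / (vol M t x + vol2 M x y) * (t / (t + dist x y)) powr \<epsilon> \<le> A * 2 powr \<epsilon> * q ^ j / measure M (B j)"
      using kernel_le_annulus[OF t \<epsilon>, of y x] unfolding B_def q_def by metis
    have "h y \<le> a * (1 / (vol M t x + vol2 M x y) * (t / (t + dist x y)) powr \<epsilon>)"
      using h[of y] by (simp add: mult_ac)
    also have "\<dots> \<le> a * (A * 2 powr \<epsilon> * q ^ j / measure M (B j))"
      using j(2) a by (rule mult_left_mono)
    finally have "h y \<le> c * q ^ j / measure M (B j)" by (simp add: c_def mult_ac)
    then have "ennreal (h y * F y) \<le> ennreal (c * q ^ j / measure M (B j) * F y)"
      using F0 by (intro ennreal_leI mult_right_mono)
    also have "\<dots> = ennreal (c * q ^ j / measure M (B j)) * (ennreal (F y) * indicator (B j) y)"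
      using j(1) c q B(2)[of j] F0 by (subst ennreal_mult) auto
    also have "\<dots> \<le> (\<Sum>j. ennreal (c * q ^ j / measure M (B j)) * (ennreal (F y) * indicator (B j) y))"
      using sum_le_suminf[OF summableI, of "{j}"] by auto
    finally show ?thesis .
  qed
  then have "(\<integral>\<^sup>+y. ennreal (h y * F y) \<partial>M)
     \<le> (\<integral>\<^sup>+y. (\<Sum>j. ennreal (c * q ^ j / measure M (B j)) * (ennreal (F y) * indicator (B j) y)) \<partial>M)"
    by (intro nn_integral_mono)
  also have "\<dots> = (\<Sum>j. ennreal (c * q ^ j / measure M (B j)) * (\<integral>\<^sup>+y\<in>B j. ennreal (F y) \<partial>M))"
    using B(1) by (subst nn_integral_suminf) (auto simp: nn_integral_cmult)
  also have "\<dots> \<le> (\<Sum>j. ennreal (c * b * (real (Suc j) * q ^ j)))"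
  proof (intro suminf_le summableI)
    fix j
    have "ennreal (c * q ^ j / measure M (B j)) * (\<integral>\<^sup>+y\<in>B j. ennreal (F y) \<partial>M)
      \<le> ennreal (c * q ^ j / measure M (B j)) * ennreal (b * (real j + 1) * measure M (B j))"
      unfolding B_def by (intro mult_left_mono F_ball) simp
    also have "\<dots> = ennreal (c * b * (real (Suc j) * q ^ j))"
    proof (subst ennreal_mult[symmetric])
      have "c * q ^ j / measure M (B j) * (b * (real j + 1) * measure M (B j)) = c * b * (real (Suc j) * q ^ j)"
        using B(2)[of j] by (simp add: less_imp_neq[symmetric])
      then show "ennreal (c * q ^ j / measure M (B j) * (b * (real j + 1) * measure M (B j)))
          = ennreal (c * b * (real (Suc j) * q ^ j))" by simp
    qed (use c b q in auto)
    finally show "ennreal (c * q ^ j / measure M (B j)) * (\<integral>\<^sup>+y\<in>B j. ennreal (F y) \<partial>M)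
      \<le> ennreal (c * b * (real (Suc j) * q ^ j))" .
  qed
  also have "\<dots> = ennreal (a * b * tail_const \<epsilon>)"
  proof -
    have sums: "(\<lambda>j. c * b * (real (Suc j) * q ^ j)) sums (c * b * (1 / (1 - q)\<^sup>2))"
      using geometric_deriv_sums[of q] q by (intro sums_mult) simp
    have "0 \<le> c * b * (real (Suc j) * q ^ j)" for j using c b q by simp
    then have "(\<Sum>j. ennreal (c * b * (real (Suc j) * q ^ j))) = ennreal (\<Sum>j. c * b * (real (Suc j) * q ^ j))"
      using sums_summable[OF sums] by (rule suminf_ennreal2)
    also have "\<dots> = ennreal (c * b * (1 / (1 - q)\<^sup>2))"
      by (simp only: sums_unique[OF sums])
    finally show ?thesis by (simp add: tail_const_def c_def q_def mult_ac)
  qed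
  finally show ?thesis .
qed

end

context bmo_function
begin

lemma integrable_kernel_mult:
  fixes s :: "'a \<Rightarrow> complex" and g :: "'a \<Rightarrow> complex"
  assumes [measurable]: "s \<in> borel_measurable M" "g \<in> borel_measurable M"
    and le: "(\<integral>\<^sup>+y. ennreal (cmod (s y) * cmod (g y)) \<partial>M) \<le> ennreal b" and b: "0 \<le> b"
  shows "integrable M (\<lambda>y. s y * g y)" "cmod (LINT y|M. s y * g y) \<le> b"
proof -
  show int: "integrable M (\<lambda>y. s y * g y)"
    using le by (intro integrableI_bounded) (auto simp: norm_mult le_less_trans)
  have "ennreal (cmod (LINT y|M. s y * g y)) \<le> ennreal b"
    using integral_norm_bound_ennreal[OF int] le by (simp add: norm_mult)
  then show "cmod (LINT y|M. s y * g y) \<le> b" using b by simp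
qed

text \<open>
  As the kernel has integral one, subtracting the mean \<open>c\<close> over \<open>B(x,t)\<close> turns \<open>s\<close> applied to
  \<open>f\<close> into \<open>s\<close> applied to \<open>f - c\<close>, and the averages of \<open>|f - c|\<close> over dyadic balls grow linearly.
\<close>

lemma approx_identity_mean:
  fixes s :: "'a \<Rightarrow> complex"
  assumes t: "0 < t" and \<epsilon>: "0 < \<epsilon>" and a: "0 \<le> a"
    and s [measurable]: "s \<in> borel_measurable M"
    and bound: "\<And>y. cmod (s y) \<le> a * (1 / (vol M t x + vol2 M x y)) * (t / (t + dist x y)) powr \<epsilon>"
    and one: "(LINT y|M. s y) = 1"
  shows "integrable M (\<lambda>y. s y * f y)"
    and "cmod ((LINT y|M. s y * f y) - mean x t) \<le> a * (A\<^sup>2 * n) * tail_const \<epsilon>"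
proof -
  let ?c = "mean x t"
  have F: "(\<integral>\<^sup>+y\<in>ball x (2 ^ j * t). ennreal (cmod (f y - ?c)) \<partial>M)
      \<le> ennreal (A\<^sup>2 * n * (real j + 1) * measure M (ball x (2 ^ j * t)))" for j
  proof -
    let ?B = "ball x (2 ^ j * t)" and ?d = "mean x (2 ^ j * t)"
    have j: "0 < 2 ^ j * t" using t by simp
    have "ennreal (cmod (f y - ?c)) \<le> ennreal (cmod (f y - ?d)) + ennreal (real j * (A\<^sup>2 * n))" for y
    proof -
      have "cmod (f y - ?c) \<le> cmod (f y - ?d) + real j * (A\<^sup>2 * n)"
        by (rule norm_diff_triangle_le[OF order.refl])
           (subst norm_minus_commute, rule mean_dyadic[OF t])
      then have "ennreal (cmod (f y - ?c)) \<le> ennreal (cmod (f y - ?d) + real j * (A\<^sup>2 * n))"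
        by (rule ennreal_leI)
      then show ?thesis using n_pos by simp
    qed
    then have "(\<integral>\<^sup>+y\<in>?B. ennreal (cmod (f y - ?c)) \<partial>M)
       \<le> (\<integral>\<^sup>+y\<in>?B. (ennreal (cmod (f y - ?d)) + ennreal (real j * (A\<^sup>2 * n))) \<partial>M)"
      by (intro nn_integral_mono mult_right_mono) auto
    also have "\<dots> = (\<integral>\<^sup>+y\<in>?B. ennreal (cmod (f y - ?d)) \<partial>M) + ennreal (real j * (A\<^sup>2 * n)) * emeasure M ?B"
      by (subst nn_set_integral_add) (auto simp: nn_integral_cmult_indicator)
    also have "\<dots> \<le> ennreal (n * measure M ?B) + ennreal (real j * (A\<^sup>2 * n)) * ennreal (measure M ?B)"
      using oscillation[OF j] by (intro add_mono) (auto simp: nn_integral_cmod_diff ennreal_leI emeasure_ball[OF j])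
    also have "\<dots> = ennreal ((n * 1 + real j * (A\<^sup>2 * n)) * measure M ?B)"
      using n_pos by (simp add: distrib_right ennreal_mult)
    also have "\<dots> \<le> ennreal (A\<^sup>2 * n * (real j + 1) * measure M ?B)"
    proof (intro ennreal_leI mult_right_mono)
      have "n * 1 \<le> n * A\<^sup>2" using n_pos A_power_ge_1 by (intro mult_left_mono) auto
      then show "n * 1 + real j * (A\<^sup>2 * n) \<le> A\<^sup>2 * n * (real j + 1)"
        by (simp add: algebra_simps)
    qed simp
    finally show ?thesis .
  qed
  have le: "(\<integral>\<^sup>+y. ennreal (cmod (s y) * cmod (f y - ?c)) \<partial>M) \<le> ennreal (a * (A\<^sup>2 * n) * tail_const \<epsilon>)"
    by (rule kernel_integral_le[OF t \<epsilon> a _ _ _ bound F]) (use n_pos in auto)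
  have nonneg: "0 \<le> a * (A\<^sup>2 * n) * tail_const \<epsilon>"
    using a n_pos tail_const_pos[OF \<epsilon>] by simp
  have diff: "integrable M (\<lambda>y. s y * (f y - ?c))" "cmod (LINT y|M. s y * (f y - ?c)) \<le> a * (A\<^sup>2 * n) * tail_const \<epsilon>"
    by (rule integrable_kernel_mult[OF s _ le nonneg]; measurable)+
  have const: "integrable M (\<lambda>y. s y * ?c)"
    using one not_integrable_integral_eq[of M s] by (intro integrable_mult_left) auto
  have eq: "s y * f y = s y * (f y - ?c) + s y * ?c" for y by (simp add: algebra_simps)
  show "integrable M (\<lambda>y. s y * f y)"
    unfolding eq using diff(1) const by (rule Bochner_Integration.integrable_add)
  have "(LINT y|M. s y * f y) = (LINT y|M. s y * (f y - ?c)) + ?c"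
    unfolding eq by (subst Bochner_Integration.integral_add[OF diff(1) const]) (simp add: one)
  then show "cmod ((LINT y|M. s y * f y) - ?c) \<le> a * (A\<^sup>2 * n) * tail_const \<epsilon>"
    using diff(2) by simp
qed

end

locale bmo_rho_function = bmo_function M A f n for M :: "'a::metric_space measure" and A f n +
  fixes \<rho> :: "'a \<Rightarrow> real"
  assumes rho_pos: "\<And>x. 0 < \<rho> x"
    and large_average: "\<And>x r. 0 < r \<Longrightarrow> \<rho> x \<le> r \<Longrightarrow>
      (LINT y:ball x r|M. cmod (f y)) \<le> n * measure M (ball x r)"
begin

lemma mean_large:
  assumes "0 < r" "\<rho> x \<le> r"
  shows "cmod (mean x r) \<le> n"
proof -
  have "measure M (ball x r) * cmod (mean x r) \<le> n * measure M (ball x r)"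
    using mean_diff_le[OF assms(1) order.refl, of x 0] large_average[OF assms] by simp
  then show ?thesis using measure_ball_pos[OF assms(1), of x] by simp
qed

text \<open>
  From radius \<open>s\<close> it takes about \<open>log\<^sub>2 (\<rho>(x)/s)\<close> doublings to reach a large ball, where the
  average is at most \<open>n\<close>, and each doubling moves the mean by a multiple of \<open>n\<close>.  The logarithm is
  absorbed into a power of exponent \<open>\<delta>\<close>.
\<close>

lemma average_cmod_le:
  assumes s: "0 < s" and \<delta>: "0 < \<delta>" "\<delta> \<le> 1"
  shows "(LINT y:ball x s|M. cmod (f y)) \<le> growth_const \<delta> * n * (1 + \<rho> x / s) powr \<delta> * measure M (ball x s)"
proof -
  define k where "k = (LEAST k. \<rho> x \<le> 2 ^ k * s)"
  have "\<exists>k. \<rho> x / s < 2 ^ k" by (rule real_arch_pow) simp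
  then have "\<exists>k. \<rho> x \<le> 2 ^ k * s" using s by (auto simp: field_simps intro: less_imp_le)
  then have k: "\<rho> x \<le> 2 ^ k * s" unfolding k_def by (rule LeastI_ex)
  have two_k: "2 ^ k \<le> 2 * (1 + \<rho> x / s)"
  proof (cases k)
    case 0
    then show ?thesis using rho_pos[of x] s by simp
  next
    case (Suc l)
    have "2 ^ l * s < \<rho> x"
      using not_less_Least[of l "\<lambda>k. \<rho> x \<le> 2 ^ k * s"] Suc by (simp add: k_def)
    then show ?thesis using Suc s by (simp add: field_simps)
  qed
  define \<beta> where "\<beta> = 2 powr \<delta> - 1"
  have \<beta>: "0 < \<beta>" "\<beta> \<le> 1"
    using \<delta> powr_mono[of \<delta> 1 2] by (auto simp: \<beta>_def)
  \<comment> \<open>Bernoulli bounds the number of doublings by a multiple of their total factor to the power \<open>\<delta>\<close>.\<close>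
  have "\<beta> * (1 + real k) \<le> 1 + real k * \<beta>" using \<beta> by (simp add: algebra_simps)
  also have "\<dots> \<le> (1 + \<beta>) ^ k" using \<beta> by (intro Bernoulli_inequality) simp
  also have "\<dots> = (2 ^ k) powr \<delta>"
    by (simp add: \<beta>_def powr_realpow[symmetric] powr_powr powr_power mult_ac)
  also have "\<dots> \<le> (2 * (1 + \<rho> x / s)) powr \<delta>"
    using two_k \<delta> by (intro powr_mono2) auto
  also have "\<dots> = 2 powr \<delta> * (1 + \<rho> x / s) powr \<delta>"
    using rho_pos[of x] s by (intro powr_mult) 
  finally have kk: "1 + real k \<le> 2 powr \<delta> / \<beta> * (1 + \<rho> x / s) powr \<delta>"
    using \<beta>(1) by (simp add: field_simps)
  have "cmod (mean x s) \<le> cmod (mean x s - mean x (2 ^ k * s)) + cmod (mean x (2 ^ k * s))"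
    using norm_triangle_sub[of "mean x s" "mean x (2 ^ k * s)"] by simp
  also have "\<dots> \<le> real k * (A\<^sup>2 * n) + n"
    using mean_dyadic[OF s, of x k] mean_large[of "2 ^ k * s" x] k s by (intro add_mono) auto
  finally have m: "cmod (mean x s) \<le> real k * (A\<^sup>2 * n) + n" .
  let ?\<mu> = "measure M (ball x s)"
  have "(LINT y:ball x s|M. cmod (f y)) \<le> (LINT y:ball x s|M. cmod (f y - mean x s)) + ?\<mu> * cmod (mean x s)"
    using integral_cmod_diff_shift[OF s, of x 0 "mean x s"] by simp
  also have "\<dots> \<le> n * ?\<mu> + ?\<mu> * (real k * (A\<^sup>2 * n) + n)"
    using m by (intro add_mono oscillation s mult_left_mono) auto
  also have "\<dots> = (2 * n + real k * (A\<^sup>2 * n)) * ?\<mu>" by (simp add: algebra_simps)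
  also have "\<dots> \<le> (2 * A\<^sup>2 * n * (1 + real k)) * ?\<mu>"
  proof (intro mult_right_mono)
    have "n * 1 \<le> n * A\<^sup>2" using n_pos A_power_ge_1 by (intro mult_left_mono) auto
    moreover have "0 \<le> real k * (A\<^sup>2 * n)" using n_pos by simp
    ultimately show "2 * n + real k * (A\<^sup>2 * n) \<le> 2 * A\<^sup>2 * n * (1 + real k)"
      by (simp add: algebra_simps)
  qed simp
  also have "\<dots> \<le> (2 * A\<^sup>2 * n * (2 powr \<delta> / \<beta> * (1 + \<rho> x / s) powr \<delta>)) * ?\<mu>"
    using kk n_pos by (intro mult_right_mono mult_left_mono) auto
  finally show ?thesis by (simp add: growth_const_def \<beta>_def mult_ac)
qed

text \<open>
  Without cancellation, only the size of \<open>f\<close> can be used; its growth \<open>(1 + \<rho>(x)/t)\<^sup>\<delta>\<close> at small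
  scales is exactly the reciprocal of the factor \<open>(t/(t + \<rho>(x)))\<^sup>\<delta>\<close> in the kernel.
\<close>

lemma perturbation_le:
  fixes s :: "'a \<Rightarrow> complex"
  assumes t: "0 < t" and \<gamma>: "0 < \<gamma>" and \<delta>: "0 < \<delta>" "\<delta> \<le> 1" and a: "0 \<le> a"
    and s [measurable]: "s \<in> borel_measurable M"
    and bound: "\<And>y. cmod (s y) \<le> a * (t / (t + \<rho> x)) powr \<delta> * (1 / (vol M t x + vol2 M x y)) * (t / (t + dist x y)) powr \<gamma>"
  shows "integrable M (\<lambda>y. s y * f y)"
    and "cmod (LINT y|M. s y * f y) \<le> a * (growth_const \<delta> * n) * tail_const \<gamma>"
proof -
  define p where "p = (1 + \<rho> x / t) powr \<delta>"
  have "1 + \<rho> x / t = (t + \<rho> x) / t" using t by (simp add: add_divide_distrib)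
  moreover have "t + \<rho> x \<noteq> 0" using t rho_pos[of x] by linarith
  ultimately have "t / (t + \<rho> x) * (1 + \<rho> x / t) = 1" using t by simp
  moreover have "0 < 1 + \<rho> x / t" using t rho_pos[of x] by (simp add: add_pos_pos)
  ultimately have p: "0 < p" "(t / (t + \<rho> x)) powr \<delta> * p = 1"
    using t by (simp_all add: p_def flip: powr_mult)
  have F: "(\<integral>\<^sup>+y\<in>ball x (2 ^ j * t). ennreal (cmod (f y)) \<partial>M)
      \<le> ennreal (growth_const \<delta> * n * p * (real j + 1) * measure M (ball x (2 ^ j * t)))" for j
  proof -
    let ?B = "ball x (2 ^ j * t)"
    have "(\<integral>\<^sup>+y\<in>?B. ennreal (cmod (f y)) \<partial>M) = ennreal (LINT y:?B|M. cmod (f y))"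
      using nn_integral_cmod_diff[of 0 x "2 ^ j * t"] by simp
    also have "\<dots> \<le> ennreal (growth_const \<delta> * n * (1 + \<rho> x / (2 ^ j * t)) powr \<delta> * measure M ?B)"
      using t \<delta> by (intro ennreal_leI average_cmod_le) auto
    also have "\<dots> \<le> ennreal (growth_const \<delta> * n * (p * (real j + 1)) * measure M ?B)"
    proof (intro ennreal_leI mult_right_mono mult_left_mono)
      have "t \<le> 2 ^ j * t" using t by simp
      then have "(1 + \<rho> x / (2 ^ j * t)) powr \<delta> \<le> p"
        unfolding p_def using t rho_pos[of x] \<delta>
        by (intro powr_mono2 add_left_mono divide_left_mono) (auto simp: add_nonneg_nonneg)
      also have "p \<le> p * (real j + 1)" using p by simp
      finally show "(1 + \<rho> x / (2 ^ j * t)) powr \<delta> \<le> p * (real j + 1)" .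
    qed (use growth_const_pos[OF \<delta>(1)] n_pos in auto)
    finally show ?thesis by (simp add: mult_ac)
  qed
  have le: "(\<integral>\<^sup>+y. ennreal (cmod (s y) * cmod (f y)) \<partial>M)
     \<le> ennreal (a * (t / (t + \<rho> x)) powr \<delta> * (growth_const \<delta> * n * p) * tail_const \<gamma>)"
    by (rule kernel_integral_le[OF t \<gamma> _ _ _ _ bound F])
       (use n_pos a p(1) growth_const_pos[OF \<delta>(1)] in simp_all)
  also have "a * (t / (t + \<rho> x)) powr \<delta> * (growth_const \<delta> * n * p) = a * (growth_const \<delta> * n)"
    using p(2) by (simp add: mult_ac)
  finally have le: "(\<integral>\<^sup>+y. ennreal (cmod (s y) * cmod (f y)) \<partial>M) \<le> ennreal (a * (growth_const \<delta> * n) * tail_const \<gamma>)" .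
  have nonneg: "0 \<le> a * (growth_const \<delta> * n) * tail_const \<gamma>"
    using a n_pos tail_const_pos[OF \<gamma>] growth_const_pos[OF \<delta>(1)] by simp
  show "integrable M (\<lambda>y. s y * f y)"
    by (rule integrable_kernel_mult(1)[OF s f_measurable le nonneg])
  show "cmod (LINT y|M. s y * f y) \<le> a * (growth_const \<delta> * n) * tail_const \<gamma>"
    by (rule integrable_kernel_mult(2)[OF s f_measurable le nonneg])
qed

end

section \<open>Maximal functions of operators close to the means\<close>

lemma nn_avg_le_iff:
  assumes "0 < emeasure M B" "emeasure M B < \<infinity>"
  shows "nn_avg M B g \<le> ennreal c \<longleftrightarrow> (\<integral>\<^sup>+y\<in>B. g y \<partial>M) \<le> ennreal c * emeasure M B"
proof
  assume "nn_avg M B g \<le> ennreal c"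
  then have "nn_avg M B g * emeasure M B \<le> ennreal c * emeasure M B" by (rule mult_right_mono) simp
  moreover have "nn_avg M B g * emeasure M B = (\<integral>\<^sup>+y\<in>B. g y \<partial>M)"
    using assms by (simp add: nn_avg_def ennreal_divide_times)
  ultimately show "(\<integral>\<^sup>+y\<in>B. g y \<partial>M) \<le> ennreal c * emeasure M B" by simp
next
  assume "(\<integral>\<^sup>+y\<in>B. g y \<partial>M) \<le> ennreal c * emeasure M B"
  then show "nn_avg M B g \<le> ennreal c"
    unfolding nn_avg_def using assms by (intro divide_le_posI_ennreal) (auto simp: mult.commute)
qed

text \<open>
  The factor two arises on large balls, where the oscillation is estimated by the average of
  \<open>|f|\<close> plus the modulus of the mean.
\<close>

lemma (in locally_integrable) bmo_rho_functionI:
  assumes \<rho>: "\<And>x. 0 < \<rho> x" and N: "0 < N" and bmo: "bmo_norm M \<rho> f \<le> ennreal N"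
  shows "bmo_rho_function M A f (2 * N) \<rho>"
proof -
  have le: "(LINT y:ball x r|M. cmod (f y - c)) \<le> N * measure M (ball x r)"
    if r: "0 < r" and avg: "nn_avg M (ball x r) (\<lambda>y. ennreal (cmod (f y - c))) \<le> ennreal N" for x r c
  proof -
    have "ennreal (LINT y:ball x r|M. cmod (f y - c)) \<le> ennreal (N * measure M (ball x r))"
      using avg N ball_pos[OF r, of x] ball_fin[OF r, of x]
      by (simp add: nn_avg_le_iff nn_integral_cmod_diff emeasure_ball[OF r] ennreal_mult)
    then show ?thesis using N by simp
  qed
  have small: "nn_avg M (ball x r) (\<lambda>y. ennreal (cmod (f y - mean x r))) \<le> ennreal N"
    if "(x, r) \<in> small_balls \<rho>" for x r
  proof -
    have "nn_avg M (ball x r) (\<lambda>y. ennreal (cmod (f y - mean x r))) \<le> bmo_norm M \<rho> f"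
      unfolding bmo_norm_def using that by (intro add_increasing2[OF zero_le SUP_upper2[of "(x, r)"]]) auto
    then show ?thesis using bmo by (rule order.trans)
  qed
  have large: "nn_avg M (ball x r) (\<lambda>y. ennreal (cmod (f y))) \<le> ennreal N"
    if "(x, r) \<in> large_balls \<rho>" for x r
  proof -
    have "nn_avg M (ball x r) (\<lambda>y. ennreal (cmod (f y))) \<le> bmo_norm M \<rho> f"
      unfolding bmo_norm_def using that by (intro add_increasing[OF zero_le SUP_upper2[of "(x, r)"]]) auto
    then show ?thesis using bmo by (rule order.trans)
  qed
  have large_le: "(LINT y:ball x r|M. cmod (f y)) \<le> N * measure M (ball x r)"
    if "0 < r" "\<rho> x \<le> r" for x r
    using le[of r x 0] large[of x r] that by (simp add: large_balls_def)
  have osc: "(LINT y:ball x r|M. cmod (f y - mean x r)) \<le> 2 * N * measure M (ball x r)" if r: "0 < r" for x r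
  proof (cases "\<rho> x \<le> r")
    case True
    have "measure M (ball x r) * cmod (mean x r) \<le> N * measure M (ball x r)"
      using mean_diff_le[OF r order.refl, of x 0] large_le[OF r True] by simp
    then show ?thesis
      using integral_cmod_diff_shift[OF r, of x "mean x r" 0] large_le[OF r True] by simp
  next
    case False
    have "N * measure M (ball x r) \<le> 2 * N * measure M (ball x r)"
      using N by (intro mult_right_mono) auto
    then show ?thesis using le[OF r small[of x r]] r False by (simp add: small_balls_def)
  qed
  show ?thesis
  proof
    show "(LINT y:ball x r|M. cmod (f y)) \<le> 2 * N * measure M (ball x r)" if "0 < r" "\<rho> x \<le> r" for x r
    proof -
      have "N * measure M (ball x r) \<le> 2 * N * measure M (ball x r)"
        using N by (intro mult_right_mono) auto
      then show ?thesis using large_le[OF that] by linarith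
    qed
  qed (use N \<rho> osc in auto)
qed

text \<open>
  Isolates what the BLO estimate takes from the operators: only their distance from the means enters,
  so \<open>T t x\<close> stands for the value of the operator with parameter \<open>t\<close> applied to \<open>f\<close>.
\<close>

locale near_mean_maximal = bmo_rho_function M A f n \<rho>
  for M :: "'a::metric_space measure" and A f n \<rho> +
  fixes T :: "real \<Rightarrow> 'a \<Rightarrow> complex" and P :: "'a \<Rightarrow> ennreal" and K :: real
  assumes K: "0 \<le> K"
    and near_mean: "\<And>t x. 0 < t \<Longrightarrow> cmod (T t x - mean x t) \<le> K * n"
    and P_def: "\<And>x. P x = (SUP t\<in>{0<..}. ennreal (cmod (T t x)))"
    and P_measurable [measurable]: "P \<in> borel_measurable M"
begin

lemma T_le_mean: "0 < t \<Longrightarrow> cmod (T t x) \<le> cmod (mean x t) + K * n"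
  using near_mean[of t x] norm_triangle_sub[of "T t x" "mean x t"] by simp

lemma mean_le_T: "0 < t \<Longrightarrow> cmod (mean x t) \<le> cmod (T t x) + K * n"
  using near_mean[of t x] norm_triangle_sub[of "mean x t" "T t x"] by (simp add: norm_minus_commute)

lemma mean_le_shift: "0 < t \<Longrightarrow> dist x y < t \<Longrightarrow> cmod (mean x t) \<le> cmod (mean y t) + 2 * A\<^sup>2 * n"
  using mean_shift[of t x y] norm_triangle_sub[of "mean x t" "mean y t"] by simp

lemma T_le_P: "0 < t \<Longrightarrow> ennreal (cmod (T t x)) \<le> P x"
  unfolding P_def by (intro SUP_upper) auto

text \<open>
  Scales up to \<open>r\<close> are absorbed by the local excess and the mean over \<open>B(x0,r)\<close>; larger scales
  have to be supplied by the caller.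
\<close>

lemma P_leI:
  assumes r: "0 < r" and c: "0 \<le> c"
    and top: "cmod (mean x0 r) \<le> c"
    and large: "\<And>t. r < t \<Longrightarrow> cmod (T t x) \<le> A\<^sup>2 * n + K * n + c"
  shows "P x \<le> excess x0 r x + ennreal (A\<^sup>2 * n + K * n + c)"
  unfolding P_def
proof (rule SUP_least)
  fix t :: real assume "t \<in> {0<..}"
  then have t: "0 < t" by simp
  have nn: "0 \<le> A\<^sup>2 * n" "0 \<le> K * n" using n_pos K by auto
  show "ennreal (cmod (T t x)) \<le> excess x0 r x + ennreal (A\<^sup>2 * n + K * n + c)"
  proof (cases "t \<le> r")
    case True
    have "cmod (T t x) \<le> cmod (mean x t - mean x0 r) + (K * n + c)"
      using T_le_mean[OF t, of x] norm_triangle_sub[of "mean x t" "mean x0 r"] top by simp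
    then have "ennreal (cmod (T t x)) \<le> ennreal (cmod (mean x t - mean x0 r) + (K * n + c))"
      by (rule ennreal_leI)
    also have "\<dots> = ennreal (cmod (mean x t - mean x0 r)) + ennreal (K * n + c)"
      using nn c by (intro ennreal_plus) auto
    also have "\<dots> \<le> (excess x0 r x + ennreal (A\<^sup>2 * n)) + ennreal (K * n + c)"
      by (intro add_right_mono mean_le_excess t True)
    also have "\<dots> = excess x0 r x + ennreal (A\<^sup>2 * n + K * n + c)"
      using nn c by (simp add: add.assoc)
    finally show ?thesis .
  next
    case False
    then have "ennreal (cmod (T t x)) \<le> ennreal (A\<^sup>2 * n + K * n + c)"
      using large[of t] by (intro ennreal_leI) simp
    then show ?thesis by (rule add_increasing[rotated]) simp
  qed
qed

lemma P_le_large: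
  assumes r: "0 < r" "\<rho> x0 \<le> r" and x: "x \<in> ball x0 r"
  shows "P x \<le> excess x0 r x + ennreal (transfer_const K * n)"
proof -
  have n_le: "n \<le> A\<^sup>2 * n" using n_pos A_power_ge_1[of 2] by simp
  have "P x \<le> excess x0 r x + ennreal (A\<^sup>2 * n + K * n + (A\<^sup>2 * n + n))"
  proof (rule P_leI[OF r(1)])
    show "cmod (mean x0 r) \<le> A\<^sup>2 * n + n" using mean_large[OF r] n_le n_pos by linarith
    show "cmod (T t x) \<le> A\<^sup>2 * n + K * n + (A\<^sup>2 * n + n)" if "r < t" for t
      using T_le_mean[of t x] mean_le_shift[of t x x0] mean_large[of t x0] that r x
      by (simp add: dist_commute algebra_simps)
  qed (use n_le n_pos in linarith)
  also have "\<dots> \<le> excess x0 r x + ennreal (transfer_const K * n)"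
    unfolding transfer_const_def using n_le n_pos K
    by (intro add_left_mono ennreal_leI) (auto simp: algebra_simps intro: add_increasing)
  finally show ?thesis .
qed

text \<open>
  Means at scales \<open>t \<ge> r\<close> around \<open>x\<close>, the centre, and \<open>y\<close> are comparable, and those around \<open>y\<close>
  are dominated by \<open>P y\<close>.  Since \<open>y\<close> is arbitrary in the ball, \<open>P y\<close> can be replaced by the
  infimum of \<open>P\<close>.
\<close>

lemma P_le_small:
  assumes r: "0 < r" and x: "x \<in> ball x0 r" and y: "y \<in> ball x0 r"
  shows "P x \<le> excess x0 r x + ennreal (transfer_const K * n) + P y"
proof (cases "P y")
  case (real p)
  have Ty: "cmod (T t y) \<le> p" if "0 < t" for t
    using T_le_P[OF that, of y] real by simp
  have nn: "0 \<le> A\<^sup>2 * n" "0 \<le> K * n" using n_pos K by auto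
  have "P x \<le> excess x0 r x + ennreal (A\<^sup>2 * n + K * n + (3 * A\<^sup>2 * n + K * n + p))"
  proof (rule P_leI[OF r])
    show "cmod (mean x0 r) \<le> 3 * A\<^sup>2 * n + K * n + p"
      using mean_le_shift[of r x0 y] mean_le_T[of r y] Ty[of r] r y nn by simp
    show "cmod (T t x) \<le> A\<^sup>2 * n + K * n + (3 * A\<^sup>2 * n + K * n + p)" if t: "r < t" for t
    proof -
      have "cmod (mean x t) \<le> cmod (mean x0 t) + 2 * A\<^sup>2 * n"
        using t r x by (intro mean_le_shift) (auto simp: dist_commute)
      moreover have "cmod (mean x0 t) \<le> cmod (mean y t) + 2 * A\<^sup>2 * n"
        using t r y by (intro mean_le_shift) auto
      ultimately show ?thesis
        using T_le_mean[of t x] mean_le_T[of t y] Ty[of t] t r by (simp add: algebra_simps)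
    qed
  qed (use nn real in simp)
  also have "A\<^sup>2 * n + K * n + (3 * A\<^sup>2 * n + K * n + p) = transfer_const K * n + p"
    by (simp add: transfer_const_def algebra_simps)
  also have "excess x0 r x + ennreal (transfer_const K * n + p) = excess x0 r x + ennreal (transfer_const K * n) + P y"
    using real n_pos K by (simp add: transfer_const_def add.assoc)
  finally show ?thesis .
qed simp

text \<open>
  Additivity of the integral is used for \<open>h\<close> minus a constant and that constant, both measurable, and
  \<open>nn_integral_excess\<close> is applied to the difference; the excess itself is never integrated.
\<close>

lemma nn_integral_le_blo_const:
  assumes r: "0 < r" and h [measurable]: "h \<in> borel_measurable M"
    and le: "\<And>x. x \<in> ball x0 r \<Longrightarrow> h x \<le> excess x0 r x + ennreal (transfer_const K * n)"
  shows "(\<integral>\<^sup>+x\<in>ball x0 r. h x \<partial>M) \<le> ennreal (blo_const K * n) * emeasure M (ball x0 r)"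
proof -
  have nonneg: "0 \<le> transfer_const K * n" using n_pos K by (simp add: transfer_const_def)
  have "(\<integral>\<^sup>+x\<in>ball x0 r. h x \<partial>M) \<le> (\<integral>\<^sup>+x\<in>ball x0 r. ((h x - ennreal (transfer_const K * n)) + ennreal (transfer_const K * n)) \<partial>M)"
  proof (intro nn_integral_mono mult_right_mono)
    show "h x \<le> (h x - ennreal (transfer_const K * n)) + ennreal (transfer_const K * n)" for x
      by (cases "ennreal (transfer_const K * n) \<le> h x") (auto simp: diff_add_cancel_ennreal intro: add_increasing)
  qed simp
  also have "\<dots> = (\<integral>\<^sup>+x\<in>ball x0 r. (h x - ennreal (transfer_const K * n)) \<partial>M) + ennreal (transfer_const K * n) * emeasure M (ball x0 r)"
    by (subst nn_set_integral_add) (auto simp: nn_integral_cmult_indicator)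
  also have "\<dots> \<le> ennreal (2 * jump * measure M (ball x0 r)) + ennreal (transfer_const K * n) * emeasure M (ball x0 r)"
    using le by (intro add_right_mono nn_integral_excess r) (auto simp: ennreal_minus_le_iff add.commute)
  also have "\<dots> = ennreal ((2 * jump + transfer_const K * n) * measure M (ball x0 r))"
    using nonneg jump_pos by (simp add: emeasure_ball[OF r] distrib_right ennreal_mult'[symmetric])
  also have "2 * jump + transfer_const K * n = blo_const K * n"
    by (simp add: blo_const_def jump_def algebra_simps)
  also have "ennreal (blo_const K * n * measure M (ball x0 r)) = ennreal (blo_const K * n) * emeasure M (ball x0 r)"
    by (simp add: emeasure_ball[OF r] ennreal_mult'')
  finally show ?thesis .
qed

lemma nn_integral_P_large:
  "0 < r \<Longrightarrow> \<rho> x0 \<le> r \<Longrightarrow> (\<integral>\<^sup>+x\<in>ball x0 r. P x \<partial>M) \<le> ennreal (blo_const K * n) * emeasure M (ball x0 r)"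
  by (intro nn_integral_le_blo_const P_measurable P_le_large)

lemma nn_integral_P_finite: "(\<integral>\<^sup>+y\<in>ball x r. P y \<partial>M) < \<infinity>"
proof -
  let ?R = "max r (\<rho> x)"
  have R: "0 < ?R" using rho_pos[of x] by simp
  have "(\<integral>\<^sup>+y\<in>ball x r. P y \<partial>M) \<le> (\<integral>\<^sup>+y\<in>ball x ?R. P y \<partial>M)"
    by (intro nn_set_integral_set_mono subset_ball) simp
  also have "\<dots> \<le> ennreal (blo_const K * n) * emeasure M (ball x ?R)"
    using R by (intro nn_integral_P_large) auto
  also have "\<dots> < \<infinity>" using ball_fin[OF R, of x] by (simp add: ennreal_mult_less_top)
  finally show ?thesis .
qed

lemma P_finite_AE: "AE x in M. P x < \<infinity>"
proof -
  fix x0 :: 'a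
  have "AE x in M. x \<in> ball x0 (real i) \<longrightarrow> P x < \<infinity>" for i
  proof -
    have "AE x in M. P x * indicator (ball x0 (real i)) x \<noteq> \<infinity>"
      using nn_integral_P_finite[of x0 "real i"] by (intro nn_integral_PInf_AE) auto
    then show ?thesis by eventually_elim (auto simp: less_top)
  qed
  then have "AE x in M. \<forall>i. x \<in> ball x0 (real i) \<longrightarrow> P x < \<infinity>"
    by (simp only: AE_all_countable) blast
  then show ?thesis
  proof eventually_elim
    case (elim x)
    obtain i where "dist x0 x < real i" using reals_Archimedean2 by blast
    then show ?case using elim by auto
  qed
qed

lemma L1_loc_P: "(\<lambda>x. enn2real (P x)) \<in> L1_loc M"
proof -
  have "integrable M (\<lambda>y. indicator (ball x r) y *\<^sub>R enn2real (P y))" for x r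
  proof (rule integrableI_bounded)
    have "(\<integral>\<^sup>+y. ennreal (norm (indicator (ball x r) y *\<^sub>R enn2real (P y))) \<partial>M) \<le> (\<integral>\<^sup>+y\<in>ball x r. P y \<partial>M)"
    proof (rule nn_integral_mono)
      show "ennreal (norm (indicator (ball x r) y *\<^sub>R enn2real (P y))) \<le> P y * indicator (ball x r) y" for y
        by (cases "P y") (auto simp: indicator_def)
    qed
    also have "\<dots> < \<infinity>" by (rule nn_integral_P_finite)
    finally show "(\<integral>\<^sup>+y. ennreal (norm (indicator (ball x r) y *\<^sub>R enn2real (P y))) \<partial>M) < \<infinity>" .
  qed measurable
  then show ?thesis by (simp add: L1_loc_def set_integrable_def)
qed

lemma nn_avg_large:
  assumes "0 < r" "\<rho> x \<le> r"
  shows "nn_avg M (ball x r) (\<lambda>y. ennreal \<bar>enn2real (P y)\<bar>) \<le> ennreal (blo_const K * n)"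
proof -
  have "(\<integral>\<^sup>+y\<in>ball x r. ennreal \<bar>enn2real (P y)\<bar> \<partial>M) \<le> (\<integral>\<^sup>+y\<in>ball x r. P y \<partial>M)"
  proof (intro nn_integral_mono mult_right_mono)
    show "ennreal \<bar>enn2real (P y)\<bar> \<le> P y" for y by (cases "P y") auto
  qed simp
  then show ?thesis
    using nn_integral_P_large[OF assms] ball_pos ball_fin assms(1) by (simp add: nn_avg_le_iff)
qed

lemma ess_inf_ge:
  assumes "c < \<infinity>" "\<And>y. y \<in> B \<Longrightarrow> c \<le> P y"
  shows "ereal (enn2real c) \<le> ess_inf M B (\<lambda>y. enn2real (P y))"
  unfolding ess_inf_def
proof (rule Sup_upper, rule CollectI)
  show "AE y in M. y \<in> B \<longrightarrow> ereal (enn2real c) \<le> ereal (enn2real (P y))"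
    using P_finite_AE
  proof eventually_elim
    case (elim y)
    then show ?case using assms(2)[of y] by (auto intro!: enn2real_mono)
  qed
qed

text \<open>
  The pointwise infimum \<open>c\<close> of \<open>P\<close> over the ball is a lower bound for the essential infimum, so the
  integrand is at most \<open>P - c\<close> almost everywhere, and \<open>P_le_small\<close> bounds this by the excess.
\<close>

lemma nn_avg_small:
  assumes r: "0 < r"
  shows "nn_avg M (ball x0 r) (\<lambda>y. e2ennreal (ereal (enn2real (P y)) - ess_inf M (ball x0 r) (\<lambda>y. enn2real (P y))))
    \<le> ennreal (blo_const K * n)"
proof -
  let ?B = "ball x0 r"
  define e where "e = ess_inf M ?B (\<lambda>y. enn2real (P y))"
  define c where "c = (INF y\<in>?B. P y)"
  have c_le: "c \<le> P y" if "y \<in> ?B" for y unfolding c_def using that by (rule INF_lower)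
  \<comment> \<open>Finiteness of \<open>c\<close> is needed: in the extended nonnegative reals \<open>\<infinity> - \<infinity>\<close> is not zero.\<close>
  have "\<exists>y\<in>?B. P y < \<infinity>"
  proof (rule ccontr)
    assume "\<not> ?thesis"
    with P_finite_AE have "AE y in M. y \<notin> ?B" by auto
    then have "emeasure M ?B = 0"
      by (subst (asm) AE_iff_measurable[where N = ?B]) auto
    then show False using ball_pos[OF r, of x0] by simp
  qed
  then have c_fin: "c < \<infinity>" using c_le by (meson le_less_trans)
  have e: "ereal (enn2real c) \<le> e" unfolding e_def using c_fin c_le by (rule ess_inf_ge)
  have "(\<integral>\<^sup>+y\<in>?B. e2ennreal (ereal (enn2real (P y)) - e) \<partial>M) \<le> (\<integral>\<^sup>+y\<in>?B. (P y - c) \<partial>M)"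
  proof (rule nn_integral_mono_AE)
    show "AE y in M. e2ennreal (ereal (enn2real (P y)) - e) * indicator ?B y \<le> (P y - c) * indicator ?B y"
      using P_finite_AE
    proof eventually_elim
      case (elim y)
      then obtain p where p: "0 \<le> p" "P y = ennreal p" by (cases "P y") auto
      obtain q where q: "0 \<le> q" "c = ennreal q" using c_fin by (cases c) auto
      have "e2ennreal (ereal p - e) \<le> e2ennreal (ereal p - ereal q)"
        using e q by (intro e2ennreal_mono ereal_minus_mono) auto
      also have "\<dots> = ennreal p - ennreal q"
        using q(1) by (simp add: ennreal_minus)
      finally show ?case using p q by (auto intro!: mult_right_mono)
    qed
  qed
  also have "\<dots> \<le> ennreal (blo_const K * n) * emeasure M ?B"
  proof (rule nn_integral_le_blo_const[OF r])
    fix x assume x: "x \<in> ?B"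
    let ?X = "excess x0 r x + ennreal (transfer_const K * n)"
    show "P x - c \<le> ?X"
    proof (cases "?X = top")
      case False
      have "P x - ?X \<le> P y" if "y \<in> ?B" for y
        using P_le_small[OF r x that] False by (simp add: ennreal_minus_le_iff)
      then have "P x - ?X \<le> c" unfolding c_def by (intro INF_greatest)
      then show ?thesis using c_fin by (auto simp: ennreal_minus_le_iff add.commute)
    qed simp
  qed measurable
  finally show ?thesis
    using ball_pos[OF r] ball_fin[OF r] by (simp add: nn_avg_le_iff e_def)
qed

lemma blo_norm_le: "blo_norm M \<rho> (\<lambda>x. enn2real (P x)) \<le> ennreal (2 * blo_const K * n)"
proof -
  have b: "0 \<le> blo_const K * n" using n_pos K by (simp add: blo_const_def transfer_const_def)
  have "blo_norm M \<rho> (\<lambda>x. enn2real (P x)) \<le> ennreal (blo_const K * n) + ennreal (blo_const K * n)"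
    unfolding blo_norm_def
  proof (intro add_mono SUP_least)
    fix p assume "p \<in> small_balls \<rho>"
    then show "(case p of (x, r) \<Rightarrow> nn_avg M (ball x r)
        (\<lambda>y. e2ennreal (ereal (enn2real (P y)) - ess_inf M (ball x r) (\<lambda>x. enn2real (P x))))) \<le> ennreal (blo_const K * n)"
      by (cases p) (simp add: small_balls_def nn_avg_small)
  next
    fix p assume "p \<in> large_balls \<rho>"
    then show "(case p of (x, r) \<Rightarrow> nn_avg M (ball x r) (\<lambda>y. ennreal \<bar>enn2real (P y)\<bar>)) \<le> ennreal (blo_const K * n)"
      using nn_avg_large by (cases p) (simp add: large_balls_def)
  qed
  also have "\<dots> = ennreal (2 * blo_const K * n)" using b by (simp add: mult_ac flip: ennreal_plus)
  finally show ?thesis .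
qed

end

section \<open>The maximal function maps BMO to BLO\<close>

lemma cont_approx_identity_size:
  assumes "cont_approx_identity M \<epsilon>1 \<epsilon>2 S s"
  shows "\<exists>A4>0. \<forall>t>0. \<forall>x y. cmod (s t x y) \<le>
       A4 * (1 / (vol M t x + vol M t y + vol2 M x y)) * (t powr \<epsilon>2 / (t + dist x y) powr \<epsilon>2)"
  using assms[unfolded cont_approx_identity_def, THEN conjunct2, THEN conjunct1]
  by (rule ex_forward) (intro conjI allI impI, erule conjunct1, drule conjunct2, drule spec, drule mp, assumption, drule conjunct1, elim allE, assumption)

theorem corollary5p2:
  fixes M :: "'a::metric_space measure"
    and \<rho> :: "'a \<Rightarrow> real"
    and T T' :: "real \<Rightarrow> ('a \<Rightarrow> complex) \<Rightarrow> 'a \<Rightarrow> complex"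
    and k k' :: "real \<Rightarrow> 'a \<Rightarrow> 'a \<Rightarrow> complex"
    and C1 \<epsilon>1 \<epsilon>2 \<delta> \<gamma> :: real
  assumes "rd_space M"
    and "admissible \<rho>"
    and "\<And>t. 0 < t \<Longrightarrow> bounded_linear_L2 M (T t)"
    and "\<And>t. 0 < t \<Longrightarrow> has_integral_kernel M (T t) (k t)"
    and "0 < C1" and "0 < \<epsilon>1" and "\<epsilon>1 \<le> 1" and "0 < \<epsilon>2"
    and "0 < \<delta>" and "\<delta> \<le> 1" and "0 < \<gamma>"
    and "cont_approx_identity M \<epsilon>1 \<epsilon>2 T' k'"
    and "\<And>t x y. 0 < t \<Longrightarrow>
           cmod (k t x y - k' t x y) \<le>
             C1 * (t / (t + \<rho> x)) powr \<delta> * (1 / (vol M t x + vol2 M x y)) *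
               (t / (t + dist x y)) powr \<gamma>"
    and "\<And>f. f \<in> BMO M \<rho> \<Longrightarrow> max_fun M k f \<in> borel_measurable M"
  shows "\<exists>C>0. \<forall>f\<in>BMO M \<rho>.
           (\<forall>t>0. \<forall>x. integrable M (\<lambda>y. k t x y * f y)) \<and>
           (AE x in M. max_fun M k f x < \<infinity>) \<and>
           (\<lambda>x. enn2real (max_fun M k f x)) \<in> BLO M \<rho> \<and>
           blo_norm M \<rho> (\<lambda>x. enn2real (max_fun M k f x)) \<le> ennreal C * bmo_norm M \<rho> f"
proof -
  note kernel = assms(4) and close = assms(13) and P_meas = assms(14)
    and pos = \<open>0 < C1\<close> \<open>0 < \<epsilon>2\<close> \<open>0 < \<delta>\<close> \<open>\<delta> \<le> 1\<close> \<open>0 < \<gamma>\<close>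
  note rd = \<open>rd_space M\<close>[unfolded rd_space_def regular_borel_measure_def]
  obtain A where A: "1 \<le> A" "\<forall>x r. 0 < r \<longrightarrow> measure M (ball x (2 * r)) \<le> A * measure M (ball x r)"
    using rd[THEN conjunct2, THEN conjunct2, THEN conjunct1] by auto
  interpret doubling_measure M A
  proof
    show "sets M = sets borel" using rd[THEN conjunct1] by (rule conjunct1)
    show "0 < emeasure M (ball x r)" "emeasure M (ball x r) < \<infinity>" if "0 < r" for x r
      using rd[THEN conjunct2, THEN conjunct1, rule_format, OF that] by simp_all
    show "measure M (ball x (2 * r)) \<le> A * measure M (ball x r)" if "0 < r" for x r
      using A(2) that by blast
  qed (rule A(1))
  have rho_pos: "0 < \<rho> x" for x using \<open>admissible \<rho>\<close> unfolding admissible_def by blast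
  have kernel': "has_integral_kernel M (T' t) (k' t)" if "0 < t" for t
    using assms(12)[unfolded cont_approx_identity_def, THEN conjunct1] that by blast
  obtain A4 where A4: "0 < A4" and size: "\<And>t x y. 0 < t \<Longrightarrow> cmod (k' t x y) \<le>
       A4 * (1 / (vol M t x + vol M t y + vol2 M x y)) * (t powr \<epsilon>2 / (t + dist x y) powr \<epsilon>2)"
    using cont_approx_identity_size[OF assms(12)] by auto
  have one: "(LINT z|M. k' t x z) = 1" if "0 < t" for t x
    using assms(12)[unfolded cont_approx_identity_def, THEN conjunct2, THEN conjunct2] that by blast
  have slice: "(\<lambda>y. K x y) \<in> borel_measurable M" if "has_integral_kernel M S K" for S K and x :: 'a
    using that measurable_Pair2[of "case_prod K" M M borel x] by (simp add: has_integral_kernel_def)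
  have k'_bound: "cmod (k' t x y) \<le> A4 * (1 / (vol M t x + vol2 M x y)) * (t / (t + dist x y)) powr \<epsilon>2"
    if t: "0 < t" for t x y
  proof -
    have "1 / (vol M t x + vol M t y + vol2 M x y) \<le> 1 / (vol M t x + vol2 M x y)"
      using measure_ball_pos[OF t, of x] by (intro divide_left_mono) (auto simp: vol_def vol2_def add_pos_nonneg)
    then have "A4 * (1 / (vol M t x + vol M t y + vol2 M x y)) * (t / (t + dist x y)) powr \<epsilon>2
        \<le> A4 * (1 / (vol M t x + vol2 M x y)) * (t / (t + dist x y)) powr \<epsilon>2"
      using A4 by (intro mult_right_mono mult_left_mono) auto
    then show ?thesis using size[OF t, of x y] t by (simp add: powr_divide)
  qed
  define K where "K = A4 * A\<^sup>2 * tail_const \<epsilon>2 + C1 * growth_const \<delta> * tail_const \<gamma>"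
  define C where "C = 2 * blo_const K"
  have K: "0 \<le> K"
    using A4 pos growth_const_pos[of \<delta>] tail_const_pos[of \<epsilon>2] tail_const_pos[of \<gamma>]
    by (simp add: K_def)
  have C: "0 < C" using blo_const_pos[OF K] by (simp add: C_def)
  have main: "(\<forall>t>0. \<forall>x. integrable M (\<lambda>y. k t x y * f y)) \<and>
      (AE x in M. max_fun M k f x < \<infinity>) \<and>
      (\<lambda>x. enn2real (max_fun M k f x)) \<in> L1_loc M \<and>
      blo_norm M \<rho> (\<lambda>x. enn2real (max_fun M k f x)) \<le> ennreal (C * (2 * N))"
    if f: "f \<in> BMO M \<rho>" and N: "0 < N" "bmo_norm M \<rho> f \<le> ennreal N" for f N
  proof -
    interpret locally_integrable M A f
      by unfold_locales (use f in \<open>simp add: BMO_def\<close>)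
    interpret bmo_rho_function M A f "2 * N" \<rho>
      by (rule bmo_rho_functionI[OF rho_pos N])
    have k_split: "integrable M (\<lambda>y. k t x y * f y) \<and>
        cmod ((LINT y|M. k t x y * f y) - mean x t) \<le> K * (2 * N)" if t: "0 < t" for t x
    proof -
      have k'_meas: "(\<lambda>y. k' t x y) \<in> borel_measurable M"
        and d_meas: "(\<lambda>y. k t x y - k' t x y) \<in> borel_measurable M"
        using slice[OF kernel[OF t]] slice[OF kernel'[OF t]] by auto
      note approx = approx_identity_mean[OF t pos(2) less_imp_le[OF A4] k'_meas k'_bound[OF t] one[OF t]]
      note pert = perturbation_le[OF t pos(5,3,4) less_imp_le[OF pos(1)] d_meas close[OF t]]
      have eq: "k t x y * f y = k' t x y * f y + (k t x y - k' t x y) * f y" for y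
        by (simp add: algebra_simps)
      have "(LINT y|M. k t x y * f y) - mean x t
          = ((LINT y|M. k' t x y * f y) - mean x t) + (LINT y|M. (k t x y - k' t x y) * f y)"
        unfolding eq using approx(1) pert(1) by (subst Bochner_Integration.integral_add) auto
      then have "cmod ((LINT y|M. k t x y * f y) - mean x t)
          \<le> A4 * (A\<^sup>2 * (2 * N)) * tail_const \<epsilon>2 + C1 * (growth_const \<delta> * (2 * N)) * tail_const \<gamma>"
        using norm_triangle_mono[OF approx(2) pert(2)] by (simp only:)
      also have "\<dots> = K * (2 * N)"
        by (simp add: K_def algebra_simps)
      finally have "cmod ((LINT y|M. k t x y * f y) - mean x t) \<le> K * (2 * N)" .
      moreover have "integrable M (\<lambda>y. k t x y * f y)"
        unfolding eq using approx(1) pert(1) by (rule Bochner_Integration.integrable_add)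
      ultimately show ?thesis by blast
    qed
    interpret near_mean_maximal M A f "2 * N" \<rho> "\<lambda>t x. LINT y|M. k t x y * f y" "max_fun M k f" K
      by unfold_locales (use K k_split P_meas[OF f] in \<open>auto simp: max_fun_def\<close>)
    show ?thesis
      using k_split P_finite_AE L1_loc_P blo_norm_le by (simp add: C_def)
  qed
  show ?thesis
  proof (intro exI[of _ "2 * C"] conjI ballI)
    show "0 < 2 * C" using C by simp
    fix f assume f: "f \<in> BMO M \<rho>"
    let ?g = "\<lambda>x. enn2real (max_fun M k f x)"
    obtain b where b: "0 \<le> b" "bmo_norm M \<rho> f = ennreal b"
      using f by (cases "bmo_norm M \<rho> f") (auto simp: BMO_def)
    have "0 < b + 1" "bmo_norm M \<rho> f \<le> ennreal (b + 1)"
      using b by (auto intro: ennreal_leI)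
    note bound1 = main[OF f this]
    \<comment> \<open>Norm bounds larger than \<open>b\<close> keep the threshold positive even if \<open>b\<close> is zero.\<close>
    have le: "blo_norm M \<rho> ?g \<le> ennreal (2 * C * b) + ennreal e" if e: "0 < e" for e
    proof -
      have "0 < b + e / (2 * C)" using b C e by (simp add: add_nonneg_pos)
      moreover have "bmo_norm M \<rho> f \<le> ennreal (b + e / (2 * C))"
        unfolding b(2) using C e by (intro ennreal_leI) simp
      ultimately have "blo_norm M \<rho> ?g \<le> ennreal (C * (2 * (b + e / (2 * C))))"
        using main[OF f] by blast
      also have "C * (2 * (b + e / (2 * C))) = 2 * C * b + e" using C by (simp add: field_simps)
      also have "ennreal (2 * C * b + e) = ennreal (2 * C * b) + ennreal e"
        using b C e by (intro ennreal_plus) auto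
      finally show ?thesis .
    qed
    have "blo_norm M \<rho> ?g \<le> ennreal (2 * C * b)"
      by (rule ennreal_le_epsilon) (rule le)
    also have "ennreal (2 * C * b) = ennreal (2 * C) * bmo_norm M \<rho> f"
      unfolding b(2) using b C by (intro ennreal_mult) auto
    finally show blo: "blo_norm M \<rho> ?g \<le> ennreal (2 * C) * bmo_norm M \<rho> f" .
    have "ennreal (2 * C) * bmo_norm M \<rho> f < \<infinity>"
      unfolding b(2) by (simp add: ennreal_mult_less_top)
    then have "blo_norm M \<rho> ?g < \<infinity>" using blo by (rule le_less_trans[rotated])
    then show "?g \<in> BLO M \<rho>" unfolding BLO_def using bound1 by blast
    show "\<forall>t>0. \<forall>x. integrable M (\<lambda>y. k t x y * f y)" "AE x in M. max_fun M k f x < \<infinity>"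
      using bound1 by blast+
  qed
qed

end
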